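(* Let $M$ be a closed connected oriented smooth manifold. The operator $\boldsymbol\nabla^{\mathrm{int}}$ is a connection on $\mathscr V\mathscr C^\infty_b$, that is, it is $\mathbb R$-linear and satisfies the product rule $$\boldsymbol\nabla^{\mathrm{int}}(vZ)=v\,\boldsymbol\nabla^{\mathrm{int}}Z+\mathbf Dv\otimes Z,\qquad v\in\mathscr F\mathscr C^\infty_b,\ Z\in\mathscr V\mathscr C^\infty_b,$$ meaning that for all $V\in\mathscr V\mathscr C^\infty_b$, $\Omega\in\Omega_1\mathscr C^\infty_b$ and $\mu\in\mathscr P$, $$\big(\boldsymbol\nabla^{\mathrm{int}}_\mu(vZ)(V,\Omega)\big)_\mu=v(\mu)\,\big((\boldsymbol\nabla^{\mathrm{int}}_\mu Z)(V,\Omega)\big)_\mu+(Vv)(\mu)\,(\Omega Z)(\mu).$$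
   Context: $\mathscr P$ is the set of Borel probability measures on $M$; $\mathfrak X^\infty$ the smooth vector fields, $\Omega^\infty_1$ the smooth $1$-forms on $M$. For $f\in C^\infty(M)$ put $f^\star(\mu)=\mu f=\int f\,d\mu$. Cylinder functions: $\mathscr F\mathscr C^\infty_b$ is the algebra of functions $u:\mathscr P\to\mathbb R$ of the form $u=F\circ(f_1^\star,\dots,f_k^\star)$, $k\in\mathbb N_0$, $F\in C^\infty(\mathbb R^k)$, $f_i\in C^\infty(M)$. Cylinder vector fields: $\mathscr V\mathscr C^\infty_b:=\mathscr F\mathscr C^\infty_b\otimes_{\mathbb R}\mathfrak X^\infty$; cylinder $1$-forms: $\Omega_1\mathscr C^\infty_b:=\mathscr F\mathscr C^\infty_b\otimes_{\mathbb R}\Omega^\infty_1$ (algebraic tensor products, modules over $\mathscr F\mathscr C^\infty_b$). For $V=\sum_iu_i\otimes w_i$ set $V_\mu=\sum_iu_i(\mu)w_i$, and similarly $\Omega_\mu$. Pairing: $(\Omega V)(\mu)=\int\Omega_\mu(V_\mu)\,d\mu$. Differential: $\mathbf D:\mathscr F\mathscr C^\infty_b\to\Omega_1\mathscr C^\infty_b$, $\mathbf D_\mu u=\sum_i(\partial_iF)(f_1^\star\mu,\dots,f_k^\star\mu)\,df_i$ (independent of the representation of $u$). Action: $(Vu)(\mu)=\int(\mathbf D_\mu u)(V_\mu)\,d\mu$. The operator $\boldsymbol\nabla^{\mathrm{int}}$ is the linear extension to $\mathscr V\mathscr C^\infty_b$ of the operator defined on elementary tensors $u\otimes w$ by $$\big(\boldsymbol\nabla^{\mathrm{int}}_\mu(u\otimes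 w)(V,\Omega)\big)_\mu:=\iint\big((\mathbf D_\mu u)V_\mu\big)_x\,(\Omega_\mu w)_y\,d\mu^{\otimes2}(x,y)$$ for $V\in\mathscr V\mathscr C^\infty_b$, $\Omega\in\Omega_1\mathscr C^\infty_b$. *)

theory Defs
  imports "HOL-Probability.Probability" "HOL-Library.Function_Algebras"
begin

section \<open>Pointwise real vector space structure on functions\<close>

instantiation "fun" :: (type, real_vector) real_vector
begin

definition "r *\<^sub>R f = (\<lambda>x. r *\<^sub>R f x)"

instance
  by standard (auto simp: scaleR_fun_def plus_fun_def scaleR_add_right scaleR_add_left)

end

lemma scaleR_fun_apply [simp]: "(r *\<^sub>R f) x = r *\<^sub>R f x"
  by (simp add: scaleR_fun_def)


section \<open>Algebraic tensor product of subspaces of real vector spaces\<close>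

text \<open>
  For subspaces \<open>A\<close>, \<open>B\<close> the tensor product over the reals is the quotient of the free vector
  space on \<open>A \<times> B\<close> (finitely supported functions \<open>'a \<times> 'b \<Rightarrow> real\<close>) by the subspace generated
  by the bilinearity relations. Its elements are cosets.
\<close>

definition formal_pair :: "'a \<Rightarrow> 'b \<Rightarrow> 'a \<times> 'b \<Rightarrow> real" where
  "formal_pair a b = (\<lambda>q. if q = (a, b) then 1 else 0)"

definition formal_sums :: "'a set \<Rightarrow> 'b set \<Rightarrow> ('a \<times> 'b \<Rightarrow> real) set" where
  "formal_sums A B = {c. finite {p. c p \<noteq> 0} \<and> {p. c p \<noteq> 0} \<subseteq> A \<times> B}"

definition bilinear_relations ::
    "'a::real_vector set \<Rightarrow> 'b::real_vector set \<Rightarrow> ('a \<times> 'b \<Rightarrow> real) set" where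
  "bilinear_relations A B = span (
      {formal_pair (a + a') b - formal_pair a b - formal_pair a' b | a a' b. a \<in> A \<and> a' \<in> A \<and> b \<in> B}
    \<union> {formal_pair a (b + b') - formal_pair a b - formal_pair a b' | a b b'. a \<in> A \<and> b \<in> B \<and> b' \<in> B}
    \<union> {formal_pair (r *\<^sub>R a) b - r *\<^sub>R formal_pair a b | r a b. a \<in> A \<and> b \<in> B}
    \<union> {formal_pair a (r *\<^sub>R b) - r *\<^sub>R formal_pair a b | r a b. a \<in> A \<and> b \<in> B})"

definition tensor_class ::
    "'a::real_vector set \<Rightarrow> 'b::real_vector set \<Rightarrow> ('a \<times> 'b \<Rightarrow> real) \<Rightarrow> ('a \<times> 'b \<Rightarrow> real) set" where
  "tensor_class A B c = {c'. c' - c \<in> bilinear_relations A B}"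

definition tensor_space ::
    "'a::real_vector set \<Rightarrow> 'b::real_vector set \<Rightarrow> ('a \<times> 'b \<Rightarrow> real) set set" where
  "tensor_space A B = tensor_class A B ` formal_sums A B"

definition tensor_rep :: "('a \<times> 'b \<Rightarrow> real) set \<Rightarrow> 'a \<times> 'b \<Rightarrow> real" where
  "tensor_rep T = (SOME c. c \<in> T)"

definition tensor_add ::
    "'a::real_vector set \<Rightarrow> 'b::real_vector set \<Rightarrow>
     ('a \<times> 'b \<Rightarrow> real) set \<Rightarrow> ('a \<times> 'b \<Rightarrow> real) set \<Rightarrow> ('a \<times> 'b \<Rightarrow> real) set" where
  "tensor_add A B S T = tensor_class A B (tensor_rep S + tensor_rep T)"

definition tensor_scale ::
    "'a::real_vector set \<Rightarrow> 'b::real_vector set \<Rightarrow>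
     real \<Rightarrow> ('a \<times> 'b \<Rightarrow> real) set \<Rightarrow> ('a \<times> 'b \<Rightarrow> real) set" where
  "tensor_scale A B r T = tensor_class A B (r *\<^sub>R tensor_rep T)"

definition formal_lift :: "('a \<Rightarrow> 'b \<Rightarrow> 'c::real_vector) \<Rightarrow> ('a \<times> 'b \<Rightarrow> real) \<Rightarrow> 'c" where
  "formal_lift h c = (\<Sum>p | c p \<noteq> 0. c p *\<^sub>R h (fst p) (snd p))"

text \<open>
  Linear extension to the tensor product of a map \<open>h\<close> given on elementary tensors. It does not
  depend on the representative when \<open>h\<close> is bilinear on \<open>A \<times> B\<close>; see \<open>tensor_lift_class\<close> below.
\<close>

definition tensor_lift :: "('a \<Rightarrow> 'b \<Rightarrow> 'c::real_vector) \<Rightarrow> ('a \<times> 'b \<Rightarrow> real) set \<Rightarrow> 'c" where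
  "tensor_lift h T = formal_lift h (tensor_rep T)"

text \<open>
  Module structure when \<open>A\<close> is an algebra: \<open>v (u \<otimes> w) = (v u) \<otimes> w\<close>, extended linearly
  (computed on representatives in the free vector space).
\<close>

definition tensor_module_mult ::
    "'a::{real_vector,times} set \<Rightarrow> 'b::real_vector set \<Rightarrow>
     'a \<Rightarrow> ('a \<times> 'b \<Rightarrow> real) set \<Rightarrow> ('a \<times> 'b \<Rightarrow> real) set" where
  "tensor_module_mult A B v T = tensor_class A B (tensor_lift (\<lambda>u w. formal_pair (v * u) w) T)"

lemma formal_lift_superset:
  assumes "finite S" "{p. c p \<noteq> 0} \<subseteq> S"
  shows "formal_lift h c = (\<Sum>p\<in>S. c p *\<^sub>R h (fst p) (snd p))"
  unfolding formal_lift_def by (rule sum.mono_neutral_left) (use assms in auto)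

lemma formal_lift_pair [simp]: "formal_lift h (formal_pair a b) = h a b"
  by (subst formal_lift_superset[where S = "{(a, b)}"]) (auto simp: formal_pair_def)

lemma finite_support_pair [simp]: "finite {p. formal_pair a b p \<noteq> 0}"
  by (rule finite_subset[of _ "{(a, b)}"]) (auto simp: formal_pair_def)

lemma finite_support_add:
  fixes c c' :: "'a \<Rightarrow> real"
  assumes "finite {p. c p \<noteq> 0}" "finite {p. c' p \<noteq> 0}"
  shows "finite {p. (c + c') p \<noteq> 0}"
  by (rule finite_subset[of _ "{p. c p \<noteq> 0} \<union> {p. c' p \<noteq> 0}"]) (use assms in auto)

lemma finite_support_scaleR:
  fixes c :: "'a \<Rightarrow> real"
  assumes "finite {p. c p \<noteq> 0}"
  shows "finite {p. (r *\<^sub>R c) p \<noteq> 0}"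
  by (rule finite_subset[of _ "{p. c p \<noteq> 0}"]) (use assms in auto)

lemma finite_support_diff:
  fixes c c' :: "'a \<Rightarrow> real"
  assumes "finite {p. c p \<noteq> 0}" "finite {p. c' p \<noteq> 0}"
  shows "finite {p. (c - c') p \<noteq> 0}"
  by (rule finite_subset[of _ "{p. c p \<noteq> 0} \<union> {p. c' p \<noteq> 0}"]) (use assms in auto)

lemma formal_lift_add:
  assumes "finite {p. c p \<noteq> 0}" "finite {p. c' p \<noteq> 0}"
  shows "formal_lift h (c + c') = formal_lift h c + formal_lift h c'"
proof -
  let ?S = "{p. c p \<noteq> 0} \<union> {p. c' p \<noteq> 0}"
  show ?thesis
    by (subst (1 2 3) formal_lift_superset[where S = ?S])
      (use assms in \<open>auto simp: scaleR_add_left sum.distrib\<close>)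
qed

lemma formal_lift_scaleR:
  assumes "finite {p. c p \<noteq> 0}"
  shows "formal_lift h (r *\<^sub>R c) = r *\<^sub>R formal_lift h c"
  by (subst (1 2) formal_lift_superset[where S = "{p. c p \<noteq> 0}"])
    (use assms in \<open>auto simp: scaleR_sum_right\<close>)

lemma formal_lift_diff:
  assumes "finite {p. c p \<noteq> 0}" "finite {p. c' p \<noteq> 0}"
  shows "formal_lift h (c - c') = formal_lift h c - formal_lift h c'"
proof -
  let ?S = "{p. c p \<noteq> 0} \<union> {p. c' p \<noteq> 0}"
  show ?thesis
    by (subst (1 2 3) formal_lift_superset[where S = ?S])
      (use assms in \<open>auto simp: scaleR_diff_left sum_subtractf\<close>)
qed

lemma tensor_lift_class:
  assumes c: "c \<in> formal_sums A B"
    and "\<And>a a' b. a \<in> A \<Longrightarrow> a' \<in> A \<Longrightarrow> b \<in> B \<Longrightarrow> h (a + a') b = h a b + h a' b"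
    and "\<And>a b b'. a \<in> A \<Longrightarrow> b \<in> B \<Longrightarrow> b' \<in> B \<Longrightarrow> h a (b + b') = h a b + h a b'"
    and "\<And>r a b. a \<in> A \<Longrightarrow> b \<in> B \<Longrightarrow> h (r *\<^sub>R a) b = r *\<^sub>R h a b"
    and "\<And>r a b. a \<in> A \<Longrightarrow> b \<in> B \<Longrightarrow> h a (r *\<^sub>R b) = r *\<^sub>R h a b"
  shows "tensor_lift h (tensor_class A B c) = formal_lift h c"
proof -
  let ?N = "{c. finite {p. c p \<noteq> 0} \<and> formal_lift h c = 0}"
  have "subspace ?N"
    unfolding subspace_def
    using finite_support_add finite_support_scaleR
    by (auto simp: formal_lift_add formal_lift_scaleR simp del: plus_fun_apply scaleR_fun_apply)
      (simp_all add: formal_lift_def)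
  then have N: "bilinear_relations A B \<subseteq> ?N"
    unfolding bilinear_relations_def
    by (rule span_minimal[rotated])
      (use assms in \<open>auto simp: formal_lift_diff formal_lift_scaleR
          finite_support_diff finite_support_scaleR simp del: minus_apply scaleR_fun_apply\<close>)
  have "c - c \<in> bilinear_relations A B"
    unfolding bilinear_relations_def by (simp add: span_zero)
  then have "c \<in> tensor_class A B c"
    unfolding tensor_class_def by simp
  then have "tensor_rep (tensor_class A B c) \<in> tensor_class A B c"
    unfolding tensor_rep_def by (metis someI)
  then have "tensor_rep (tensor_class A B c) - c \<in> ?N"
    using N unfolding tensor_class_def by blast
  then have "finite {p. (tensor_rep (tensor_class A B c) - c) p \<noteq> 0}"
    and "formal_lift h (tensor_rep (tensor_class A B c) - c) = 0"
    by blast+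
  moreover have "finite {p. c p \<noteq> 0}"
    using c unfolding formal_sums_def by blast
  ultimately have "formal_lift h ((tensor_rep (tensor_class A B c) - c) + c) = formal_lift h c"
    by (subst formal_lift_add) simp_all
  then show ?thesis
    unfolding tensor_lift_def by simp
qed


section \<open>Smooth functions on open subsets of Euclidean n-space\<close>

text \<open>
  Points of \<open>\<real>\<^sup>n\<close> are the points of the library's \<open>Euclidean_space n\<close>, i.e. functions
  \<open>nat \<Rightarrow> real\<close> vanishing at all indices \<open>\<ge> n\<close>. Smoothness means that all iterated partial
  derivatives exist and are continuous.
\<close>

definition partial :: "nat \<Rightarrow> ((nat \<Rightarrow> real) \<Rightarrow> real) \<Rightarrow> (nat \<Rightarrow> real) \<Rightarrow> real" where
  "partial i F x = deriv (\<lambda>t. F (x(i := t))) (x i)"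

primrec Ck_on :: "nat \<Rightarrow> nat \<Rightarrow> (nat \<Rightarrow> real) set \<Rightarrow> ((nat \<Rightarrow> real) \<Rightarrow> real) \<Rightarrow> bool" where
  "Ck_on 0 n S F \<longleftrightarrow> continuous_map (subtopology (Euclidean_space n) S) euclideanreal F"
| "Ck_on (Suc r) n S F \<longleftrightarrow>
     continuous_map (subtopology (Euclidean_space n) S) euclideanreal F \<and>
     (\<forall>i<n. (\<forall>x\<in>S. (\<lambda>t. F (x(i := t))) differentiable (at (x i))) \<and> Ck_on r n S (partial i F))"

definition smooth_on :: "nat \<Rightarrow> (nat \<Rightarrow> real) set \<Rightarrow> ((nat \<Rightarrow> real) \<Rightarrow> real) \<Rightarrow> bool" where
  "smooth_on n S F \<longleftrightarrow> (\<forall>r. Ck_on r n S F)"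


section \<open>Closed connected oriented smooth manifolds\<close>

type_synonym 'm chart = "'m set \<times> ('m \<Rightarrow> nat \<Rightarrow> real)"

definition is_chart :: "nat \<Rightarrow> 'm::topological_space chart \<Rightarrow> bool" where
  "is_chart d = (\<lambda>(U, \<phi>). open U \<and> openin (Euclidean_space d) (\<phi> ` U) \<and>
     homeomorphic_map (top_of_set U) (subtopology (Euclidean_space d) (\<phi> ` U)) \<phi>)"

definition transition :: "'m chart \<Rightarrow> 'm chart \<Rightarrow> (nat \<Rightarrow> real) \<Rightarrow> nat \<Rightarrow> real" where
  "transition c c' x = snd c' (inv_into (fst c) (snd c) x)"

definition jacobian_det :: "nat \<Rightarrow> ((nat \<Rightarrow> real) \<Rightarrow> nat \<Rightarrow> real) \<Rightarrow> (nat \<Rightarrow> real) \<Rightarrow> real" where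
  "jacobian_det d g x =
     (\<Sum>p | p permutes {..<d}. of_int (sign p) * (\<Prod>i<d. partial (p i) (\<lambda>y. g y i) x))"

text \<open>
  The manifold is the whole type \<open>'m\<close>; an oriented atlas carries both the smooth structure and
  the orientation. The dimension \<open>d = 0\<close> is allowed.
\<close>

locale closed_connected_oriented_manifold =
  fixes d :: nat and \<A> :: "'m::{t2_space,second_countable_topology} chart set"
  assumes charts: "c \<in> \<A> \<Longrightarrow> is_chart d c"
    and cover: "(\<Union>c\<in>\<A>. fst c) = UNIV"
    and transition_smooth: "c \<in> \<A> \<Longrightarrow> c' \<in> \<A> \<Longrightarrow> j < d \<Longrightarrow>
          smooth_on d (snd c ` (fst c \<inter> fst c')) (\<lambda>x. transition c c' x j)"
    and transition_oriented: "c \<in> \<A> \<Longrightarrow> c' \<in> \<A> \<Longrightarrow> x \<in> snd c ` (fst c \<inter> fst c') \<Longrightarrow>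
          0 < jacobian_det d (transition c c') x"
    and compact_manifold: "compact (UNIV :: 'm set)"
    and connected_manifold: "connected (UNIV :: 'm set)"

definition C_inf :: "nat \<Rightarrow> 'm chart set \<Rightarrow> ('m \<Rightarrow> real) set" where
  "C_inf d \<A> = {f. \<forall>(U, \<phi>)\<in>\<A>. smooth_on d (\<phi> ` U) (\<lambda>x. f (inv_into U \<phi> x))}"

text \<open>
  Tangent vectors at \<open>x\<close> are the derivations of \<open>C\<^sup>\<infinity>(M)\<close> at \<open>x\<close>, extended by zero to
  non-smooth functions; cotangent vectors are the linear forms on the tangent space, extended by
  zero. These conventions make the representing functions unique.
\<close>

type_synonym 'm tvector = "('m \<Rightarrow> real) \<Rightarrow> real"

definition tangent_space :: "nat \<Rightarrow> 'm chart set \<Rightarrow> 'm \<Rightarrow> 'm tvector set" where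
  "tangent_space d \<A> x = {v.
     (\<forall>f. f \<notin> C_inf d \<A> \<longrightarrow> v f = 0) \<and>
     (\<forall>f\<in>C_inf d \<A>. \<forall>g\<in>C_inf d \<A>. v (f + g) = v f + v g) \<and>
     (\<forall>r. \<forall>f\<in>C_inf d \<A>. v (r *\<^sub>R f) = r * v f) \<and>
     (\<forall>f\<in>C_inf d \<A>. \<forall>g\<in>C_inf d \<A>. v (f * g) = v f * g x + f x * v g)}"

definition cotangent_space :: "nat \<Rightarrow> 'm chart set \<Rightarrow> 'm \<Rightarrow> ('m tvector \<Rightarrow> real) set" where
  "cotangent_space d \<A> x = {\<omega>.
     (\<forall>v. v \<notin> tangent_space d \<A> x \<longrightarrow> \<omega> v = 0) \<and>
     (\<forall>v\<in>tangent_space d \<A> x. \<forall>w\<in>tangent_space d \<A> x. \<omega> (v + w) = \<omega> v + \<omega> w) \<and>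
     (\<forall>r. \<forall>v\<in>tangent_space d \<A> x. \<omega> (r *\<^sub>R v) = r * \<omega> v)}"

text \<open>A vector field is smooth if it maps smooth functions to smooth functions, and a 1-form is
  smooth if it maps smooth vector fields to smooth functions.\<close>

definition vector_fields :: "nat \<Rightarrow> 'm chart set \<Rightarrow> ('m \<Rightarrow> 'm tvector) set" where
  "vector_fields d \<A> = {w. (\<forall>x. w x \<in> tangent_space d \<A> x) \<and>
     (\<forall>f\<in>C_inf d \<A>. (\<lambda>x. w x f) \<in> C_inf d \<A>)}"

definition one_forms :: "nat \<Rightarrow> 'm chart set \<Rightarrow> ('m \<Rightarrow> 'm tvector \<Rightarrow> real) set" where
  "one_forms d \<A> = {\<omega>. (\<forall>x. \<omega> x \<in> cotangent_space d \<A> x) \<and>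
     (\<forall>w\<in>vector_fields d \<A>. (\<lambda>x. \<omega> x (w x)) \<in> C_inf d \<A>)}"

definition differential :: "nat \<Rightarrow> 'm chart set \<Rightarrow> ('m \<Rightarrow> real) \<Rightarrow> 'm \<Rightarrow> 'm tvector \<Rightarrow> real" where
  "differential d \<A> f = (\<lambda>x v. if v \<in> tangent_space d \<A> x then v f else 0)"


section \<open>Cylinder functions, vector fields and 1-forms on the space of probability measures\<close>

typedef (overloaded) 'm borel_prob = "space (prob_algebra (borel :: 'm::topological_space measure))"
  morphisms measure_of_prob Abs_borel_prob
proof
  show "return borel undefined \<in> space (prob_algebra (borel :: 'm measure))"
    by (auto simp: space_prob_algebra intro!: prob_space_return)
qed

definition star :: "('m::topological_space \<Rightarrow> real) \<Rightarrow> 'm borel_prob \<Rightarrow> real" where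
  "star f \<mu> = (\<integral>x. f x \<partial>measure_of_prob \<mu>)"

definition star_tuple ::
    "nat \<Rightarrow> (nat \<Rightarrow> 'm::topological_space \<Rightarrow> real) \<Rightarrow> 'm borel_prob \<Rightarrow> nat \<Rightarrow> real" where
  "star_tuple k f \<mu> = (\<lambda>i. if i < k then star (f i) \<mu> else 0)"

definition represents ::
    "nat \<Rightarrow> 'm::topological_space chart set \<Rightarrow>
     nat \<times> ((nat \<Rightarrow> real) \<Rightarrow> real) \<times> (nat \<Rightarrow> 'm \<Rightarrow> real) \<Rightarrow> ('m borel_prob \<Rightarrow> real) \<Rightarrow> bool" where
  "represents d \<A> = (\<lambda>(k, F, f) u. smooth_on k (topspace (Euclidean_space k)) F \<and>
     (\<forall>i<k. f i \<in> C_inf d \<A>) \<and> u = (\<lambda>\<mu>. F (star_tuple k f \<mu>)))"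

definition cyl_functions ::
    "nat \<Rightarrow> 'm::topological_space chart set \<Rightarrow> ('m borel_prob \<Rightarrow> real) set" where
  "cyl_functions d \<A> = {u. \<exists>\<rho>. represents d \<A> \<rho> u}"

type_synonym 'm cyl_vector_field = "(('m borel_prob \<Rightarrow> real) \<times> ('m \<Rightarrow> 'm tvector) \<Rightarrow> real) set"
type_synonym 'm cyl_one_form =
  "(('m borel_prob \<Rightarrow> real) \<times> ('m \<Rightarrow> 'm tvector \<Rightarrow> real) \<Rightarrow> real) set"

definition cyl_vector_fields ::
    "nat \<Rightarrow> 'm::topological_space chart set \<Rightarrow> 'm cyl_vector_field set" where
  "cyl_vector_fields d \<A> = tensor_space (cyl_functions d \<A>) (vector_fields d \<A>)"

definition cyl_one_forms ::
    "nat \<Rightarrow> 'm::topological_space chart set \<Rightarrow> 'm cyl_one_form set" where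
  "cyl_one_forms d \<A> = tensor_space (cyl_functions d \<A>) (one_forms d \<A>)"

abbreviation vf_add ::
    "nat \<Rightarrow> 'm::topological_space chart set \<Rightarrow>
     'm cyl_vector_field \<Rightarrow> 'm cyl_vector_field \<Rightarrow> 'm cyl_vector_field" where
  "vf_add d \<A> \<equiv> tensor_add (cyl_functions d \<A>) (vector_fields d \<A>)"

abbreviation vf_scale ::
    "nat \<Rightarrow> 'm::topological_space chart set \<Rightarrow>
     real \<Rightarrow> 'm cyl_vector_field \<Rightarrow> 'm cyl_vector_field" where
  "vf_scale d \<A> \<equiv> tensor_scale (cyl_functions d \<A>) (vector_fields d \<A>)"

abbreviation vf_mult ::
    "nat \<Rightarrow> 'm::topological_space chart set \<Rightarrow>
     ('m borel_prob \<Rightarrow> real) \<Rightarrow> 'm cyl_vector_field \<Rightarrow> 'm cyl_vector_field" where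
  "vf_mult d \<A> \<equiv> tensor_module_mult (cyl_functions d \<A>) (vector_fields d \<A>)"

text \<open>The evaluations \<open>V\<^sub>\<mu>\<close> and \<open>\<Omega>\<^sub>\<mu>\<close> (used for both cylinder vector fields and 1-forms).\<close>

definition eval_at ::
    "(('m::topological_space borel_prob \<Rightarrow> real) \<times> 'b::real_vector \<Rightarrow> real) set \<Rightarrow>
     'm borel_prob \<Rightarrow> 'b" where
  "eval_at T \<mu> = tensor_lift (\<lambda>u w. u \<mu> *\<^sub>R w) T"

definition pairing ::
    "'m::topological_space cyl_one_form \<Rightarrow> 'm cyl_vector_field \<Rightarrow> 'm borel_prob \<Rightarrow> real" where
  "pairing \<Omega> V \<mu> = (\<integral>x. eval_at \<Omega> \<mu> x (eval_at V \<mu> x) \<partial>measure_of_prob \<mu>)"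

text \<open>The differential, computed from an arbitrarily chosen representation of \<open>u\<close>.\<close>

definition cyl_D ::
    "nat \<Rightarrow> 'm::topological_space chart set \<Rightarrow> ('m borel_prob \<Rightarrow> real) \<Rightarrow> 'm cyl_one_form" where
  "cyl_D d \<A> u = (case SOME \<rho>. represents d \<A> \<rho> u of (k, F, f) \<Rightarrow>
     tensor_class (cyl_functions d \<A>) (one_forms d \<A>)
       (\<Sum>i<k. formal_pair (\<lambda>\<mu>. partial i F (star_tuple k f \<mu>)) (differential d \<A> (f i))))"

definition vf_action ::
    "nat \<Rightarrow> 'm::topological_space chart set \<Rightarrow>
     'm cyl_vector_field \<Rightarrow> ('m borel_prob \<Rightarrow> real) \<Rightarrow> 'm borel_prob \<Rightarrow> real" where
  "vf_action d \<A> V u \<mu> = pairing (cyl_D d \<A> u) V \<mu>"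

definition nabla_int ::
    "nat \<Rightarrow> 'm::topological_space chart set \<Rightarrow>
     'm cyl_vector_field \<Rightarrow> 'm cyl_vector_field \<Rightarrow> 'm cyl_one_form \<Rightarrow> 'm borel_prob \<Rightarrow> real" where
  "nabla_int d \<A> Z V \<Omega> \<mu> = tensor_lift (\<lambda>u w.
     \<integral>z. eval_at (cyl_D d \<A> u) \<mu> (fst z) (eval_at V \<mu> (fst z)) * eval_at \<Omega> \<mu> (snd z) (w (snd z))
       \<partial>(measure_of_prob \<mu> \<Otimes>\<^sub>M measure_of_prob \<mu>)) Z"

end

theory Submission
  imports Defs
begin

text \<open>
  For a cylinder function \<open>u\<close> and \<open>x \<in> M\<close>, the derivative of \<open>u\<close> at \<open>\<mu>\<close> along the segment
  \<open>(1 - t) \<mu> + t \<delta>\<^sub>x\<close> is, up to a constant, \<open>\<phi> x = (\<Sum>i. \<partial>\<^sub>iF(\<dots>) f\<^sub>i x)\<close>. Hence \<open>\<phi>\<close> is determined by \<open>u\<close>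
  and \<open>\<mu>\<close> up to a constant, and \<open>\<^bold>D\<^sub>\<mu> u = d\<phi>\<close> does not depend on the representation of \<open>u\<close>, because
  derivations annihilate constants. Linearity and the Leibniz rule for \<open>u \<mapsto> V u\<close> are then those of
  the one-variable derivative along segments; no flows on \<open>M\<close> are needed. By Fubini the double integral
  defining the connection is \<open>(V u)(\<mu>)\<close> times \<open>\<integral>\<Omega>\<^sub>\<mu>(w) d\<mu>\<close>, so the product rule reduces to the
  Leibniz rule for the first factor.
\<close>

section \<open>Calculus of smooth functions\<close>

lemma continuous_map_into_Euclidean_space:
  assumes "\<And>i. continuous_map X euclideanreal (\<lambda>x. f x i)"
    and "\<And>x i. x \<in> topspace X \<Longrightarrow> n \<le> i \<Longrightarrow> f x i = 0"
  shows "continuous_map X (Euclidean_space n) f"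
  using assms unfolding Euclidean_space_def
  by (auto simp: continuous_map_in_subtopology continuous_map_componentwise_UNIV)

lemma continuous_map_Euclidean_space_component:
  "continuous_map (subtopology (Euclidean_space n) S) euclideanreal (\<lambda>x. x i)"
  unfolding Euclidean_space_def
  by (intro continuous_map_from_subtopology continuous_map_product_projection) simp

text \<open>The coordinate line through \<open>x\<close> is a continuous map into Euclidean space,
  so the preimage of \<open>S\<close> is open. Hence partial derivatives at points of
  \<open>S\<close> depend on the values in \<open>S\<close> alone.\<close>

lemma eventually_fun_upd_in_openin:
  assumes S: "openin (Euclidean_space n) S" and x: "x \<in> S" and i: "i < n"
  shows "\<forall>\<^sub>F t in nhds (x i). x(i := t) \<in> S"
proof -
  have x0: "x j = 0" if "n \<le> j" for j
    using openin_subset[OF S] x that by (auto simp: topspace_Euclidean_space)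
  have "continuous_map euclideanreal (Euclidean_space n) (\<lambda>t. x(i := t))"
    by (rule continuous_map_into_Euclidean_space) (use i x0 in \<open>auto simp: fun_upd_apply\<close>)
  then have "open {t. x(i := t) \<in> S}"
    using S openin_continuous_map_preimage by fastforce
  then show ?thesis
    using x by (auto simp: eventually_nhds intro!: exI[of _ "{t. x(i := t) \<in> S}"])
qed

lemma Ck_on_SucD:
  assumes "Ck_on (Suc r) n S F"
  shows "continuous_map (subtopology (Euclidean_space n) S) euclideanreal F"
    and "i < n \<Longrightarrow> Ck_on r n S (partial i F)"
    and "i < n \<Longrightarrow> x \<in> S \<Longrightarrow>
      ((\<lambda>t. F (x(i := t))) has_real_derivative partial i F x) (at (x i))"
  using assms by (auto simp: partial_def DERIV_deriv_iff_real_differentiable)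

text \<open>\<open>partial\<close> looks at a full coordinate line, which may leave
  \<open>S\<close>. Near a point of the open set \<open>S\<close> it stays inside, so functions
  equal on \<open>S\<close> have equal partial derivatives there, at every order.\<close>

lemma Ck_on_cong:
  assumes "openin (Euclidean_space n) S" "\<And>x. x \<in> S \<Longrightarrow> F x = G x" "Ck_on r n S F"
  shows "Ck_on r n S G"
  using assms(2,3)
proof (induction r arbitrary: F G)
  case 0
  then show ?case
    by (auto simp: elim!: continuous_map_eq)
next
  case (Suc r)
  have cont: "continuous_map (subtopology (Euclidean_space n) S) euclideanreal G"
    using Ck_on_SucD(1)[OF Suc.prems(2)] by (rule continuous_map_eq) (use Suc.prems in auto)
  have ev: "\<forall>\<^sub>F t in nhds (x i). F (x(i := t)) = G (x(i := t))" if "x \<in> S" "i < n" for x i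
    using eventually_fun_upd_in_openin[OF assms(1) that] by eventually_elim (use Suc.prems in auto)
  have diff: "((\<lambda>t. G (x(i := t))) has_real_derivative partial i F x) (at (x i))"
    if "x \<in> S" "i < n" for x i
    using iffD1[OF DERIV_cong_ev[OF refl ev[OF that] refl]] Ck_on_SucD(3)[OF Suc.prems(2) that(2,1)] .
  have "partial i F x = partial i G x" if "x \<in> S" "i < n" for x i
    using diff[OF that] by (simp add: partial_def[of i G] DERIV_imp_deriv)
  then have "Ck_on r n S (partial i G)" if "i < n" for i
    using that Suc.IH Ck_on_SucD(2)[OF Suc.prems(2) that] by metis
  then show ?case
    using cont diff real_differentiable_def by auto
qed

text \<open>Allows derivatives \<open>D\<close> in closed form in place of \<open>deriv\<close>
  terms: \<open>D i\<close> and \<open>partial i F\<close> agree on \<open>S\<close>, so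
  \<open>Ck_on_cong\<close> transfers regularity.\<close>

lemma Ck_on_SucI:
  assumes S: "openin (Euclidean_space n) S"
    and "continuous_map (subtopology (Euclidean_space n) S) euclideanreal F"
    and D: "\<And>i x. i < n \<Longrightarrow> x \<in> S \<Longrightarrow>
      ((\<lambda>t. F (x(i := t))) has_real_derivative D i x) (at (x i))"
    and "\<And>i. i < n \<Longrightarrow> Ck_on r n S (D i)"
  shows "Ck_on (Suc r) n S F"
proof -
  have "D i x = partial i F x" if "i < n" "x \<in> S" for i x
    using D[OF that] by (simp add: partial_def DERIV_imp_deriv)
  then have "Ck_on r n S (partial i F)" if "i < n" for i
    using Ck_on_cong[OF S] assms(4) that by metis
  then show ?thesis
    using assms(2) D real_differentiable_def by auto
qed

lemma Ck_on_continuous_map: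
  "Ck_on r n S F \<Longrightarrow> continuous_map (subtopology (Euclidean_space n) S) euclideanreal F"
  by (cases r) auto

lemma Ck_on_SucD_lower: "Ck_on (Suc r) n S F \<Longrightarrow> Ck_on r n S F"
  by (induction r arbitrary: F) auto

lemma Ck_on_const:
  assumes "openin (Euclidean_space n) S"
  shows "Ck_on r n S (\<lambda>x. c)"
proof (induction r arbitrary: c)
  case (Suc r)
  then show ?case
    by (intro Ck_on_SucI[OF assms, where D = "\<lambda>i x. 0"]) auto
qed simp

lemma Ck_on_add:
  assumes "openin (Euclidean_space n) S" "Ck_on r n S F" "Ck_on r n S G"
  shows "Ck_on r n S (\<lambda>x. F x + G x)"
  using assms(2,3)
proof (induction r arbitrary: F G)
  case 0
  then show ?case by (auto intro: continuous_map_add)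
next
  case (Suc r)
  note F = Ck_on_SucD[OF Suc.prems(1)] and G = Ck_on_SucD[OF Suc.prems(2)]
  have D: "((\<lambda>t. F (x(i := t)) + G (x(i := t))) has_real_derivative
      partial i F x + partial i G x) (at (x i))" if "i < n" "x \<in> S" for i x
    using DERIV_add[OF F(3)[OF that] G(3)[OF that]] .
  show ?case
    by (rule Ck_on_SucI[OF assms(1), where D = "\<lambda>i x. partial i F x + partial i G x"])
      (intro continuous_map_add Suc.IH F G D | assumption)+
qed

lemma Ck_on_mult:
  assumes "openin (Euclidean_space n) S" "Ck_on r n S F" "Ck_on r n S G"
  shows "Ck_on r n S (\<lambda>x. F x * G x)"
  using assms(2,3)
proof (induction r arbitrary: F G)
  case 0
  then show ?case by (auto intro: continuous_map_real_mult)
next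
  case (Suc r)
  note F = Ck_on_SucD[OF Suc.prems(1)] and G = Ck_on_SucD[OF Suc.prems(2)]
  have D: "((\<lambda>t. F (x(i := t)) * G (x(i := t))) has_real_derivative
      partial i F x * G x + partial i G x * F x) (at (x i))" if "i < n" "x \<in> S" for i x
    using DERIV_mult[OF F(3)[OF that] G(3)[OF that]] by (simp only: fun_upd_triv)
  \<comment> \<open>The derivative contains \<open>F\<close> and \<open>G\<close> undifferentiated,
    so the induction hypothesis is applied to them at the lower order \<open>r\<close>.\<close>
  show ?case
    by (rule Ck_on_SucI[OF assms(1), where D = "\<lambda>i x. partial i F x * G x + partial i G x * F x"])
      (intro continuous_map_real_mult Ck_on_add[OF assms(1)] Suc.IH F G D
        Ck_on_SucD_lower[OF Suc.prems(1)] Ck_on_SucD_lower[OF Suc.prems(2)] | assumption)+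
qed

section \<open>Composition with projections onto consecutive coordinates\<close>

definition coordinate_block :: "nat \<Rightarrow> nat \<Rightarrow> (nat \<Rightarrow> real) \<Rightarrow> nat \<Rightarrow> real" where
  "coordinate_block s k x = (\<lambda>i. if i < k then x (i + s) else 0)"

lemma coordinate_block_in_Euclidean_space [simp]:
  "coordinate_block s k x \<in> topspace (Euclidean_space k)"
  by (simp add: coordinate_block_def topspace_Euclidean_space)

text \<open>Lets functions of two separate tuples be regarded as functions of the concatenated
  tuple.\<close>

lemma Ck_on_coordinate_block:
  assumes "s + k \<le> n" "Ck_on r k (topspace (Euclidean_space k)) F"
  shows "Ck_on r n (topspace (Euclidean_space n)) (\<lambda>x. F (coordinate_block s k x))"
  using assms(2)
proof (induction r arbitrary: F)
  case (0 F)
  have "continuous_map (Euclidean_space n) (Euclidean_space k) (coordinate_block s k)"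
    using continuous_map_Euclidean_space_component[of n "topspace (Euclidean_space n)"]
    by (intro continuous_map_into_Euclidean_space) (auto simp: coordinate_block_def)
  then show ?case
    using 0 continuous_map_compose[of _ _ "coordinate_block s k" _ F] by (simp add: o_def)
next
  case (Suc r F)
  note F = Ck_on_SucD[OF Suc.prems]
  \<comment> \<open>Moving a coordinate outside the block changes nothing; inside it, index
    \<open>i\<close> of the large space is index \<open>i - s\<close> of the block.\<close>
  let ?D = "\<lambda>i x. if s \<le> i \<and> i < s + k then partial (i - s) F (coordinate_block s k x) else 0"
  have "continuous_map (Euclidean_space n) (Euclidean_space k) (coordinate_block s k)"
    using continuous_map_Euclidean_space_component[of n "topspace (Euclidean_space n)"]
    by (intro continuous_map_into_Euclidean_space) (auto simp: coordinate_block_def)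
  then have cont: "continuous_map (Euclidean_space n) euclideanreal (\<lambda>x. F (coordinate_block s k x))"
    using F(1) continuous_map_compose[of _ _ "coordinate_block s k" _ F] by (simp add: o_def)
  have D: "((\<lambda>t. F (coordinate_block s k (x(i := t)))) has_real_derivative ?D i x) (at (x i))"
    for i x
  proof (cases "s \<le> i \<and> i < s + k")
    case True
    then have block_upd: "coordinate_block s k (x(i := t)) = (coordinate_block s k x)(i - s := t)" for t
      by (auto simp: coordinate_block_def fun_eq_iff)
    have "i - s < k" "coordinate_block s k x (i - s) = x i"
      using True by (auto simp: coordinate_block_def)
    then have "((\<lambda>t. F ((coordinate_block s k x)(i - s := t))) has_real_derivative
        partial (i - s) F (coordinate_block s k x)) (at (x i))"
      using F(3)[of "i - s" "coordinate_block s k x"] by (metis coordinate_block_in_Euclidean_space)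
    with True show ?thesis
      by (simp only: block_upd) simp
  next
    case False
    then have "coordinate_block s k (x(i := t)) = coordinate_block s k x" for t
      by (auto simp: coordinate_block_def)
    then show ?thesis by (simp only: if_not_P[OF False]) simp
  qed
  have Ck: "Ck_on r n (topspace (Euclidean_space n)) (?D i)" for i
    using Suc.IH[OF F(2)[of "i - s"]] Ck_on_const[of n "topspace (Euclidean_space n)"] assms(1)
    by (cases "s \<le> i \<and> i < s + k") auto
  show ?case
    by (rule Ck_on_SucI[where D = ?D]) (rule openin_topspace, simp add: cont, rule D, rule Ck)
qed

section \<open>Closure properties of smooth functions\<close>

lemma smooth_on_const: "openin (Euclidean_space n) S \<Longrightarrow> smooth_on n S (\<lambda>x. c)"
  unfolding smooth_on_def using Ck_on_const by metis

lemma smooth_on_add: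
  "openin (Euclidean_space n) S \<Longrightarrow> smooth_on n S F \<Longrightarrow> smooth_on n S G \<Longrightarrow> smooth_on n S (\<lambda>x. F x + G x)"
  unfolding smooth_on_def using Ck_on_add by metis

lemma smooth_on_mult:
  "openin (Euclidean_space n) S \<Longrightarrow> smooth_on n S F \<Longrightarrow> smooth_on n S G \<Longrightarrow> smooth_on n S (\<lambda>x. F x * G x)"
  unfolding smooth_on_def using Ck_on_mult by metis

lemma smooth_on_coordinate_block:
  "s + k \<le> n \<Longrightarrow> smooth_on k (topspace (Euclidean_space k)) F \<Longrightarrow>
    smooth_on n (topspace (Euclidean_space n)) (\<lambda>x. F (coordinate_block s k x))"
  unfolding smooth_on_def using Ck_on_coordinate_block by metis

lemma smooth_on_partial: "i < n \<Longrightarrow> smooth_on n S F \<Longrightarrow> smooth_on n S (partial i F)"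
  unfolding smooth_on_def by (meson Ck_on_SucD(2))

lemma smooth_on_continuous_map:
  "smooth_on n S F \<Longrightarrow> continuous_map (subtopology (Euclidean_space n) S) euclideanreal F"
  unfolding smooth_on_def using Ck_on_continuous_map by blast

text \<open>The increment along the line is split into one step per coordinate; the mean value theorem
  treats each step.\<close>

lemma smooth_on_has_derivative_along_line:
  assumes F: "smooth_on k (topspace (Euclidean_space k)) F"
    and p: "\<And>i. k \<le> i \<Longrightarrow> p i = 0" and v: "\<And>i. k \<le> i \<Longrightarrow> v i = 0"
  shows "((\<lambda>t. F (\<lambda>i. p i + t * v i)) has_real_derivative (\<Sum>i<k. partial i F p * v i)) (at 0)"
proof -
  \<comment> \<open>\<open>q j t\<close> has moved the first \<open>j\<close> coordinates by the
    full increment: it is \<open>p\<close> for \<open>j = 0\<close> and reaches the line for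
    \<open>j = k\<close>.\<close>
  define q where "q j t = (\<lambda>i. if i < j then p i + t * v i else p i)" for j t
  have q_in: "(q j t)(j := s) \<in> topspace (Euclidean_space k)" if "j < k" for j t s
    using p that by (auto simp: topspace_Euclidean_space q_def)
  have F1: "Ck_on (Suc 0) k (topspace (Euclidean_space k)) F"
    using F unfolding smooth_on_def by blast
  have "((\<lambda>t. F (q j t)) has_real_derivative (\<Sum>i<j. partial i F p * v i)) (at 0)" if "j \<le> k" for j
    using that
  proof (induction j)
    case 0
    then show ?case by (simp add: q_def)
  next
    case (Suc j)
    then have j: "j < k" by simp
    \<comment> \<open>\<open>fst z\<close> is the parameter of the coordinates already moved,
      \<open>snd z\<close> that of coordinate \<open>j\<close>. Keeping them apart lets the mean
      value theorem act in the second alone, while joint continuity at the origin controls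
      both.\<close>
    define \<Phi> where "\<Phi> z = partial j F ((q j (fst z))(j := p j + snd z * v j))" for z :: "real \<times> real"
    have "continuous_map euclidean (Euclidean_space k)
        (\<lambda>z :: real \<times> real. (q j (fst z))(j := p j + snd z * v j))"
    proof (rule continuous_map_into_Euclidean_space)
      show "continuous_map euclidean euclideanreal
          (\<lambda>z :: real \<times> real. ((q j (fst z))(j := p j + snd z * v j)) i)" for i
        by (cases "i = j"; cases "i < j") (auto simp: q_def intro!: continuous_intros)
    qed (use p j in \<open>auto simp: q_def\<close>)
    moreover have "continuous_map (Euclidean_space k) euclideanreal (partial j F)"
      using Ck_on_continuous_map[OF Ck_on_SucD(2)[OF F1 j]] by simp
    ultimately have "continuous_map euclidean euclideanreal \<Phi>"
      using continuous_map_compose unfolding \<Phi>_def o_def by fast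
    then have "isCont \<Phi> (0, 0)"
      by (simp add: continuous_on_eq_continuous_at)
    moreover have \<Phi>0: "\<Phi> (0, 0) = partial j F p"
      unfolding \<Phi>_def by (rule arg_cong[of _ _ "partial j F"]) (auto simp: q_def)
    ultimately have \<Phi>_lim: "(\<Phi> \<longlongrightarrow> partial j F p) (at (0, 0))"
      by (simp add: isCont_def)
    have deriv: "((\<lambda>s. F ((q j t)(j := p j + s * v j))) has_real_derivative \<Phi> (t, s) * v j) (at s)" for t s
    proof -
      have "((\<lambda>s. F (((q j t)(j := p j + s * v j))(j := s))) has_real_derivative \<Phi> (t, s)) (at (p j + s * v j))"
        using Ck_on_SucD(3)[OF F1 j q_in[OF j]] unfolding \<Phi>_def by force
      then have "((\<lambda>s. F ((q j t)(j := s))) has_real_derivative \<Phi> (t, s)) (at (p j + s * v j))"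
        by simp
      moreover have "((\<lambda>s. p j + s * v j) has_real_derivative v j) (at s)"
        by (auto intro!: derivative_eq_intros)
      ultimately show ?thesis by (rule DERIV_chain2)
    qed
    \<comment> \<open>Mean value theorem with \<open>t\<close> frozen in the first argument.
      \<open>MVT2\<close> wants an ordered interval, hence the cases on the sign of
      \<open>t\<close>; for \<open>t = 0\<close> both sides vanish.\<close>
    have "\<exists>s. \<bar>s\<bar> \<le> \<bar>t\<bar> \<and>
        F ((q j t)(j := p j + t * v j)) - F ((q j t)(j := p j + 0 * v j)) = t * (\<Phi> (t, s) * v j)" for t
    proof (cases t "0 :: real" rule: linorder_cases)
      case less
      then obtain z where "t < z" "z < 0"
        "F ((q j t)(j := p j + 0 * v j)) - F ((q j t)(j := p j + t * v j)) = (0 - t) * (\<Phi> (t, z) * v j)"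
        using MVT2[OF less, of "\<lambda>s. F ((q j t)(j := p j + s * v j))" "\<lambda>s. \<Phi> (t, s) * v j"] deriv by blast
      then show ?thesis by (intro exI[of _ z]) (auto simp: algebra_simps)
    next
      case greater
      then obtain z where "0 < z" "z < t"
        "F ((q j t)(j := p j + t * v j)) - F ((q j t)(j := p j + 0 * v j)) = (t - 0) * (\<Phi> (t, z) * v j)"
        using MVT2[OF greater, of "\<lambda>s. F ((q j t)(j := p j + s * v j))" "\<lambda>s. \<Phi> (t, s) * v j"] deriv by blast
      then show ?thesis by (intro exI[of _ z]) auto
    qed auto
    then obtain \<sigma> where \<sigma>: "\<bar>\<sigma> t\<bar> \<le> \<bar>t\<bar>"
      and step: "F ((q j t)(j := p j + t * v j)) - F ((q j t)(j := p j + 0 * v j)) =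
        t * (\<Phi> (t, \<sigma> t) * v j)" for t
      by metis
    have q_Suc: "q (Suc j) t = (q j t)(j := p j + t * v j)" and q_j: "q j t = (q j t)(j := p j + 0 * v j)" for t
      by (auto simp: q_def)
    have eq: "F (q (Suc j) t) = F (q j t) + t * (\<Phi> (t, \<sigma> t) * v j)" for t
      using step[of t] q_Suc[of t] q_j[of t] by simp
    have "(\<sigma> \<longlongrightarrow> 0) (at 0)"
      by (rule tendsto_0_le[where K = 1 and f = "\<lambda>t. t"]) (use \<sigma> in auto)
    \<comment> \<open>\<open>\<Phi>_lim\<close> is a limit over punctured neighbourhoods of the
      origin; the point avoids the origin because its first component is nonzero.\<close>
    moreover have "\<forall>\<^sub>F t in at 0. (t, \<sigma> t) \<noteq> (0, 0)"
      using eventually_neq_at_within[of 0 0 UNIV] by (rule eventually_mono) simp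
    ultimately have "filterlim (\<lambda>t. (t, \<sigma> t)) (at (0, 0)) (at 0)"
      by (intro filterlim_atI tendsto_Pair tendsto_ident_at)
    then have "((\<lambda>t. \<Phi> (t, \<sigma> t)) \<longlongrightarrow> partial j F p) (at 0)"
      using \<Phi>_lim by (rule filterlim_compose[rotated])
    then have "((\<lambda>t. \<Phi> (t, \<sigma> t) * v j) \<longlongrightarrow> partial j F p * v j) (at 0)"
      by (intro tendsto_intros)
    then have "((\<lambda>t. (t * (\<Phi> (t, \<sigma> t) * v j) - 0) / t) \<longlongrightarrow> partial j F p * v j) (at 0)"
      by (rule Lim_transform_eventually) (auto simp: eventually_at_filter)
    then have "((\<lambda>t. t * (\<Phi> (t, \<sigma> t) * v j)) has_real_derivative partial j F p * v j) (at 0)"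
      by (simp add: has_field_derivative_iff)
    from DERIV_add[OF Suc.IH this] Suc.prems show ?case
      by (simp add: eq)
  qed
  moreover have "q k t = (\<lambda>i. p i + t * v i)" for t
    using v by (auto simp: q_def)
  ultimately show ?thesis by force
qed

section \<open>Linear maps on algebraic tensor products\<close>

text \<open>Collects the conditions of \<open>tensor_lift_class\<close>, under which a linear
  extension does not depend on the chosen representative.\<close>

definition bilinear_on ::
    "'a::real_vector set \<Rightarrow> 'b::real_vector set \<Rightarrow> ('a \<Rightarrow> 'b \<Rightarrow> 'c::real_vector) \<Rightarrow> bool" where
  "bilinear_on A B h \<longleftrightarrow>
     (\<forall>a\<in>A. \<forall>a'\<in>A. \<forall>b\<in>B. h (a + a') b = h a b + h a' b) \<and>
     (\<forall>a\<in>A. \<forall>b\<in>B. \<forall>b'\<in>B. h a (b + b') = h a b + h a b') \<and>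
     (\<forall>r. \<forall>a\<in>A. \<forall>b\<in>B. h (r *\<^sub>R a) b = r *\<^sub>R h a b) \<and>
     (\<forall>r. \<forall>a\<in>A. \<forall>b\<in>B. h a (r *\<^sub>R b) = r *\<^sub>R h a b)"

lemma tensor_lift_class_bilinear:
  "c \<in> formal_sums A B \<Longrightarrow> bilinear_on A B h \<Longrightarrow> tensor_lift h (tensor_class A B c) = formal_lift h c"
  by (rule tensor_lift_class) (auto simp: bilinear_on_def)

section \<open>Formal sums and representatives of tensors\<close>

lemma subspace_formal_sums: "subspace (formal_sums A B)"
  unfolding subspace_def
proof (intro conjI ballI allI)
  show "0 \<in> formal_sums A B"
    by (simp add: formal_sums_def)
  show "c + c' \<in> formal_sums A B" if "c \<in> formal_sums A B" "c' \<in> formal_sums A B" for c c'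
  proof -
    have "{p. (c + c') p \<noteq> 0} \<subseteq> {p. c p \<noteq> 0} \<union> {p. c' p \<noteq> 0}"
      by auto
    then show ?thesis
      using that finite_support_add[of c c'] unfolding formal_sums_def by blast
  qed
  show "r *\<^sub>R c \<in> formal_sums A B" if "c \<in> formal_sums A B" for r c
  proof -
    have "{p. (r *\<^sub>R c) p \<noteq> 0} \<subseteq> {p. c p \<noteq> 0}"
      by auto
    then show ?thesis
      using that finite_support_scaleR[of c r] unfolding formal_sums_def by blast
  qed
qed

lemma formal_sums_finite: "c \<in> formal_sums A B \<Longrightarrow> finite {p. c p \<noteq> 0}"
  by (simp add: formal_sums_def)

lemma formal_sums_support: "c \<in> formal_sums A B \<Longrightarrow> c p \<noteq> 0 \<Longrightarrow> fst p \<in> A \<and> snd p \<in> B"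
  by (auto simp: formal_sums_def)

lemma formal_pair_in_formal_sums: "a \<in> A \<Longrightarrow> b \<in> B \<Longrightarrow> formal_pair a b \<in> formal_sums A B"
  by (auto simp: formal_sums_def) (auto simp: formal_pair_def split: if_splits)

text \<open>The generators involve sums and multiples of elements of \<open>A\<close> and
  \<open>B\<close>, which stay there because both are subspaces.\<close>

lemma bilinear_relations_subset_formal_sums:
  assumes "subspace A" "subspace B"
  shows "bilinear_relations A B \<subseteq> formal_sums A B"
  unfolding bilinear_relations_def
  by (rule span_minimal[OF _ subspace_formal_sums])
    (auto intro!: subspace_diff[OF subspace_formal_sums] subspace_scale[OF subspace_formal_sums]
      formal_pair_in_formal_sums intro: subspace_add subspace_scale assms)

text \<open>\<open>tensor_rep\<close> chooses an arbitrary member of the coset; it differs from a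
  formal sum by a relation, which is itself a formal sum.\<close>

lemma tensor_rep_in_formal_sums:
  assumes "subspace A" "subspace B" "T \<in> tensor_space A B"
  shows "tensor_rep T \<in> formal_sums A B"
proof -
  obtain c where c: "c \<in> formal_sums A B" and T: "T = tensor_class A B c"
    using assms(3) by (auto simp: tensor_space_def)
  have "c \<in> T"
    by (simp add: T tensor_class_def bilinear_relations_def span_zero)
  then have "tensor_rep T - c \<in> bilinear_relations A B"
    unfolding tensor_rep_def by (metis T someI tensor_class_def mem_Collect_eq)
  then have "tensor_rep T - c \<in> formal_sums A B"
    using bilinear_relations_subset_formal_sums[OF assms(1,2)] by blast
  from subspace_add[OF subspace_formal_sums this c] show ?thesis by simp
qed

lemma formal_lift_cong:
  assumes "c \<in> formal_sums A B" "\<And>a b. a \<in> A \<Longrightarrow> b \<in> B \<Longrightarrow> h a b = h' a b"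
  shows "formal_lift h c = formal_lift h' c"
  unfolding formal_lift_def by (rule sum.cong) (auto simp: assms(2) dest: formal_sums_support[OF assms(1)])

lemma formal_lift_sum:
  assumes "finite I" "\<And>i. i \<in> I \<Longrightarrow> c i \<in> formal_sums A B"
  shows "formal_lift h (\<Sum>i\<in>I. c i) = (\<Sum>i\<in>I. formal_lift h (c i))"
  using assms
proof (induction I)
  case empty
  then show ?case by (simp add: formal_lift_def)
next
  case (insert i I)
  then have "(\<Sum>i\<in>I. c i) \<in> formal_sums A B" "c i \<in> formal_sums A B"
    by (auto intro: subspace_sum[OF subspace_formal_sums])
  note add = formal_lift_add[OF this(2,1)[THEN formal_sums_finite]]
  have "formal_lift h (\<Sum>i\<in>I. c i) = (\<Sum>i\<in>I. formal_lift h (c i))"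
    by (rule insert.IH) (use insert.prems in auto)
  then show ?case
    by (simp only: sum.insert[OF insert.hyps] add)
qed

section \<open>Linear extension and the operations on tensors\<close>

lemma tensor_lift_add:
  assumes "subspace A" "subspace B" "bilinear_on A B h" "S \<in> tensor_space A B" "T \<in> tensor_space A B"
  shows "tensor_lift h (tensor_add A B S T) = tensor_lift h S + tensor_lift h T"
proof -
  have reps: "tensor_rep S \<in> formal_sums A B" "tensor_rep T \<in> formal_sums A B"
    using assms tensor_rep_in_formal_sums by blast+
  show ?thesis
    unfolding tensor_add_def
    by (subst tensor_lift_class_bilinear[OF subspace_add[OF subspace_formal_sums reps] assms(3)])
      (simp add: tensor_lift_def formal_lift_add reps[THEN formal_sums_finite])
qed

lemma tensor_lift_scale:
  assumes "subspace A" "subspace B" "bilinear_on A B h" "T \<in> tensor_space A B"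
  shows "tensor_lift h (tensor_scale A B r T) = r *\<^sub>R tensor_lift h T"
proof -
  have rep: "tensor_rep T \<in> formal_sums A B"
    using assms tensor_rep_in_formal_sums by blast
  show ?thesis
    unfolding tensor_scale_def
    by (subst tensor_lift_class_bilinear[OF subspace_scale[OF subspace_formal_sums rep] assms(3)])
      (simp add: tensor_lift_def formal_lift_scaleR rep[THEN formal_sums_finite])
qed

text \<open>Both sides become sums over the support of the same \<open>tensor_rep T\<close>;
  bilinearity of \<open>h\<close> enters when passing to the class of the multiplied formal
  sum.\<close>

lemma tensor_lift_module_mult:
  assumes "subspace A" "subspace B" "bilinear_on A B h" "T \<in> tensor_space A B"
    and v: "\<And>u. u \<in> A \<Longrightarrow> v * u \<in> A"
  shows "tensor_lift h (tensor_module_mult A B v T) = tensor_lift (\<lambda>u w. h (v * u) w) T"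
proof -
  let ?c = "tensor_rep T"
  let ?g = "\<lambda>p. ?c p *\<^sub>R formal_pair (v * fst p) (snd p)"
  have rep: "?c \<in> formal_sums A B"
    using assms tensor_rep_in_formal_sums by blast
  have pair: "formal_pair (v * fst p) (snd p) \<in> formal_sums A B" if "?c p \<noteq> 0" for p
    using formal_sums_support[OF rep that] by (simp add: formal_pair_in_formal_sums v)
  have g: "?g p \<in> formal_sums A B" if "p \<in> {p. ?c p \<noteq> 0}" for p
    using pair that by (intro subspace_scale[OF subspace_formal_sums]) auto
  have "tensor_lift h (tensor_module_mult A B v T) = formal_lift h (\<Sum>p | ?c p \<noteq> 0. ?g p)"
    unfolding tensor_module_mult_def tensor_lift_def[of _ T] formal_lift_def[of _ ?c]
    by (rule tensor_lift_class_bilinear[OF subspace_sum[OF subspace_formal_sums g] assms(3)])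
  also have "\<dots> = (\<Sum>p | ?c p \<noteq> 0. formal_lift h (?g p))"
    by (rule formal_lift_sum[OF formal_sums_finite[OF rep] g])
  also have "\<dots> = tensor_lift (\<lambda>u w. h (v * u) w) T"
    unfolding tensor_lift_def formal_lift_def[of _ ?c] by (simp add: formal_lift_scaleR)
  finally show ?thesis .
qed

lemma tensor_add_in_tensor_space:
  assumes "subspace A" "subspace B" "S \<in> tensor_space A B" "T \<in> tensor_space A B"
  shows "tensor_add A B S T \<in> tensor_space A B"
  unfolding tensor_add_def tensor_space_def
  by (intro imageI subspace_add[OF subspace_formal_sums] tensor_rep_in_formal_sums assms)

lemma tensor_scale_in_tensor_space:
  assumes "subspace A" "subspace B" "T \<in> tensor_space A B"
  shows "tensor_scale A B r T \<in> tensor_space A B"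
  unfolding tensor_scale_def tensor_space_def
  by (intro imageI subspace_scale[OF subspace_formal_sums] tensor_rep_in_formal_sums assms)

lemma tensor_module_mult_in_tensor_space:
  assumes "subspace A" "subspace B" "T \<in> tensor_space A B" and v: "\<And>u. u \<in> A \<Longrightarrow> v * u \<in> A"
  shows "tensor_module_mult A B v T \<in> tensor_space A B"
proof -
  have rep: "tensor_rep T \<in> formal_sums A B"
    using assms tensor_rep_in_formal_sums by blast
  then have "tensor_lift (\<lambda>u w. formal_pair (v * u) w) T \<in> formal_sums A B"
    unfolding tensor_lift_def formal_lift_def
    by (intro subspace_sum[OF subspace_formal_sums] subspace_scale[OF subspace_formal_sums])
      (auto intro!: formal_pair_in_formal_sums v dest: formal_sums_support)
  then show ?thesis
    unfolding tensor_module_mult_def tensor_space_def by blast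
qed

text \<open>Serves maps known to be linear on a subspace: tangent vectors on smooth functions and
  \<open>flux\<close> on vector fields.\<close>

lemma linear_on_sum:
  fixes L :: "'b::real_vector \<Rightarrow> 'c::real_vector"
  assumes "subspace B" "finite I" "\<And>i. i \<in> I \<Longrightarrow> b i \<in> B"
    and add: "\<And>b b'. b \<in> B \<Longrightarrow> b' \<in> B \<Longrightarrow> L (b + b') = L b + L b'"
    and scale: "\<And>r b. b \<in> B \<Longrightarrow> L (r *\<^sub>R b) = r *\<^sub>R L b"
  shows "L (\<Sum>i\<in>I. r i *\<^sub>R b i) = (\<Sum>i\<in>I. r i *\<^sub>R L (b i))"
  using assms(2,3)
proof (induction I)
  case empty
  then show ?case
    using scale[OF subspace_0[OF assms(1)], of 0] by simp
next
  case (insert i I)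
  then have "(\<Sum>i\<in>I. r i *\<^sub>R b i) \<in> B" "r i *\<^sub>R b i \<in> B"
    by (auto intro: subspace_sum subspace_scale assms(1))
  then show ?case
    using insert by (simp add: add scale)
qed

lemma bilinear_on_eval: "bilinear_on A B (\<lambda>u w. u \<mu> *\<^sub>R w)"
  by (simp add: bilinear_on_def scaleR_add_left scaleR_add_right)

lemma eval_at_in:
  assumes "subspace A" "subspace B" "T \<in> tensor_space A B"
  shows "eval_at T \<mu> \<in> B"
proof -
  have "tensor_rep T \<in> formal_sums A B"
    using assms tensor_rep_in_formal_sums by blast
  then show ?thesis
    unfolding eval_at_def tensor_lift_def formal_lift_def
    by (auto intro!: subspace_sum subspace_scale assms(2) dest: formal_sums_support)
qed

section \<open>Smooth functions, vector fields and 1-forms\<close>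

context closed_connected_oriented_manifold
begin

lemma chart_image_openin: "(U, \<phi>) \<in> \<A> \<Longrightarrow> openin (Euclidean_space d) (\<phi> ` U)"
  using charts by (fastforce simp: is_chart_def)

lemma C_inf_const: "(\<lambda>x. c) \<in> C_inf d \<A>"
  using chart_image_openin smooth_on_const by (fastforce simp: C_inf_def)

lemma C_inf_add: "f \<in> C_inf d \<A> \<Longrightarrow> g \<in> C_inf d \<A> \<Longrightarrow> f + g \<in> C_inf d \<A>"
  using chart_image_openin smooth_on_add by (fastforce simp: C_inf_def)

lemma C_inf_mult: "f \<in> C_inf d \<A> \<Longrightarrow> g \<in> C_inf d \<A> \<Longrightarrow> f * g \<in> C_inf d \<A>"
  using chart_image_openin smooth_on_mult by (fastforce simp: C_inf_def)

lemma C_inf_scaleR: "f \<in> C_inf d \<A> \<Longrightarrow> r *\<^sub>R f \<in> C_inf d \<A>"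
  using C_inf_mult[OF C_inf_const[of r], of f] by (simp add: times_fun_def scaleR_fun_def)

lemma subspace_C_inf: "subspace (C_inf d \<A>)"
  using C_inf_const[of 0] C_inf_add C_inf_scaleR by (simp add: subspace_def zero_fun_def)

text \<open>On a chart domain \<open>f\<close> is its coordinate expression composed with the chart
  homeomorphism, and the open chart domains cover the manifold.\<close>

lemma C_inf_continuous:
  assumes "f \<in> C_inf d \<A>"
  shows "continuous_on UNIV f"
proof -
  have "isCont f x" for x
  proof -
    obtain U \<phi> where c: "(U, \<phi>) \<in> \<A>" "x \<in> U"
      using cover by fastforce
    have U: "open U" and \<phi>: "homeomorphic_map (top_of_set U) (subtopology (Euclidean_space d) (\<phi> ` U)) \<phi>"
      using charts[OF c(1)] by (auto simp: is_chart_def)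
    have inj: "inj_on \<phi> U"
      using homeomorphic_imp_injective_map[OF \<phi>] by simp
    have "continuous_map (subtopology (Euclidean_space d) (\<phi> ` U)) euclideanreal (\<lambda>x. f (inv_into U \<phi> x))"
      using assms c(1) smooth_on_continuous_map by (fastforce simp: C_inf_def)
    from continuous_map_compose[OF homeomorphic_imp_continuous_map[OF \<phi>] this]
    have "continuous_on U (\<lambda>x. f (inv_into U \<phi> (\<phi> x)))"
      by (simp add: o_def)
    then have "continuous_on U f"
      using inj by (simp cong: continuous_on_cong)
    then show ?thesis
      using U c(2) continuous_on_eq_continuous_at by blast
  qed
  then show ?thesis
    by (simp add: continuous_at_imp_continuous_on)
qed

lemma C_inf_borel_measurable: "f \<in> C_inf d \<A> \<Longrightarrow> f \<in> borel_measurable borel"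
  by (simp add: C_inf_continuous borel_measurable_continuous_onI)

text \<open>Compactness enters here; boundedness makes smooth functions integrable against every
  probability measure.\<close>

lemma C_inf_bounded:
  assumes "f \<in> C_inf d \<A>"
  obtains B where "\<And>x. \<bar>f x\<bar> \<le> B"
proof -
  have "bounded (range f)"
    using compact_imp_bounded compact_continuous_image C_inf_continuous[OF assms] compact_manifold by blast
  then show ?thesis
    using that by (auto simp: bounded_iff)
qed

section \<open>Tangent vectors, vector fields and 1-forms\<close>

lemma subspace_tangent_space: "subspace (tangent_space d \<A> x)"
  by (auto simp: subspace_def tangent_space_def algebra_simps)

text \<open>The Leibniz rule for \<open>1 * 1 = 1\<close> shows that \<open>v\<close> takes a value
  on \<open>1\<close> equal to its own double, hence zero; homogeneity gives the other
  constants.\<close>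

lemma tangent_space_const:
  assumes "v \<in> tangent_space d \<A> x"
  shows "v (\<lambda>x. c) = 0"
proof -
  have one: "(\<lambda>x. 1 :: real) \<in> C_inf d \<A>"
    by (rule C_inf_const)
  have "v ((\<lambda>x. 1) * (\<lambda>x. 1)) = v (\<lambda>x. 1) * 1 + 1 * v (\<lambda>x. 1)"
    using assms one by (auto simp: tangent_space_def)
  moreover have "v (c *\<^sub>R (\<lambda>x. 1)) = c * v (\<lambda>x. 1)"
    using assms one by (auto simp: tangent_space_def)
  ultimately show ?thesis
    by (simp add: times_fun_def scaleR_fun_def)
qed

lemma tangent_space_add:
  "v \<in> tangent_space d \<A> x \<Longrightarrow> f \<in> C_inf d \<A> \<Longrightarrow> g \<in> C_inf d \<A> \<Longrightarrow> v (f + g) = v f + v g"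
  by (simp add: tangent_space_def)

lemma tangent_space_scaleR:
  "v \<in> tangent_space d \<A> x \<Longrightarrow> f \<in> C_inf d \<A> \<Longrightarrow> v (r *\<^sub>R f) = r * v f"
  by (simp add: tangent_space_def)

lemma subspace_cotangent_space: "subspace (cotangent_space d \<A> x)"
  by (auto simp: subspace_def cotangent_space_def algebra_simps)

lemma vector_fields_tangent: "w \<in> vector_fields d \<A> \<Longrightarrow> w x \<in> tangent_space d \<A> x"
  by (simp add: vector_fields_def)

lemma vector_fields_smooth: "w \<in> vector_fields d \<A> \<Longrightarrow> f \<in> C_inf d \<A> \<Longrightarrow> (\<lambda>x. w x f) \<in> C_inf d \<A>"
  by (simp add: vector_fields_def)

lemma subspace_vector_fields: "subspace (vector_fields d \<A>)"
  unfolding subspace_def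
proof (intro conjI ballI allI)
  show "0 \<in> vector_fields d \<A>"
    using subspace_0[OF subspace_tangent_space] C_inf_const[of 0] by (simp add: vector_fields_def)
  show "w + w' \<in> vector_fields d \<A>" if "w \<in> vector_fields d \<A>" "w' \<in> vector_fields d \<A>" for w w'
    using that subspace_add[OF subspace_tangent_space] C_inf_add[unfolded plus_fun_def]
    by (simp add: vector_fields_def)
  show "r *\<^sub>R w \<in> vector_fields d \<A>" if "w \<in> vector_fields d \<A>" for r w
    using that subspace_scale[OF subspace_tangent_space] C_inf_scaleR[unfolded scaleR_fun_def]
    by (simp add: vector_fields_def)
qed

lemma one_forms_smooth: "\<omega> \<in> one_forms d \<A> \<Longrightarrow> w \<in> vector_fields d \<A> \<Longrightarrow> (\<lambda>x. \<omega> x (w x)) \<in> C_inf d \<A>"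
  by (simp add: one_forms_def)

lemma one_forms_add:
  "\<omega> \<in> one_forms d \<A> \<Longrightarrow> w \<in> vector_fields d \<A> \<Longrightarrow> w' \<in> vector_fields d \<A> \<Longrightarrow>
    \<omega> x ((w + w') x) = \<omega> x (w x) + \<omega> x (w' x)"
  using vector_fields_tangent by (auto simp: one_forms_def cotangent_space_def)

lemma one_forms_scaleR:
  "\<omega> \<in> one_forms d \<A> \<Longrightarrow> w \<in> vector_fields d \<A> \<Longrightarrow> \<omega> x ((r *\<^sub>R w) x) = r * \<omega> x (w x)"
  using vector_fields_tangent by (auto simp: one_forms_def cotangent_space_def)

lemma subspace_one_forms: "subspace (one_forms d \<A>)"
  unfolding subspace_def
proof (intro conjI ballI allI)
  show "0 \<in> one_forms d \<A>"
    using subspace_0[OF subspace_cotangent_space] C_inf_const[of 0] by (simp add: one_forms_def)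
  show "w + w' \<in> one_forms d \<A>" if "w \<in> one_forms d \<A>" "w' \<in> one_forms d \<A>" for w w'
    using that subspace_add[OF subspace_cotangent_space] C_inf_add[unfolded plus_fun_def]
    by (simp add: one_forms_def)
  show "r *\<^sub>R w \<in> one_forms d \<A>" if "w \<in> one_forms d \<A>" for r w
    using that subspace_scale[OF subspace_cotangent_space] C_inf_scaleR[unfolded scaleR_fun_def]
    by (simp add: one_forms_def)
qed

text \<open>On a smooth vector field \<open>w\<close> the form takes the values
  \<open>w x f\<close>, which depend smoothly on \<open>x\<close> by the definition of
  \<open>vector_fields\<close>.\<close>

lemma differential_in_one_forms:
  assumes "f \<in> C_inf d \<A>"
  shows "differential d \<A> f \<in> one_forms d \<A>"
proof -
  have "differential d \<A> f x \<in> cotangent_space d \<A> x" for x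
    using subspace_add[OF subspace_tangent_space, of _ x] subspace_scale[OF subspace_tangent_space, of _ x]
    by (simp add: cotangent_space_def differential_def)
  moreover have "differential d \<A> f x (w x) = w x f" if "w \<in> vector_fields d \<A>" for w x
    using vector_fields_tangent[OF that] by (simp add: differential_def)
  ultimately show ?thesis
    using assms vector_fields_smooth by (simp add: one_forms_def)
qed

end

section \<open>Cylinder functions\<close>

lemma fun_sum_apply: "(\<Sum>i\<in>I. f i) x = (\<Sum>i\<in>I. f i x)"
  by (induction I rule: infinite_finite_induct) auto

context closed_connected_oriented_manifold
begin

lemma cyl_functionsE:
  assumes "u \<in> cyl_functions d \<A>"
  obtains k F f where "smooth_on k (topspace (Euclidean_space k)) F" "\<And>i. i < k \<Longrightarrow> f i \<in> C_inf d \<A>"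
    "u = (\<lambda>\<mu>. F (star_tuple k f \<mu>))"
  using assms by (auto simp: cyl_functions_def represents_def)

lemma cyl_functionsI:
  assumes "smooth_on k (topspace (Euclidean_space k)) F" "\<And>i. i < k \<Longrightarrow> f i \<in> C_inf d \<A>"
  shows "(\<lambda>\<mu>. F (star_tuple k f \<mu>)) \<in> cyl_functions d \<A>"
  unfolding cyl_functions_def mem_Collect_eq
  by (rule exI[of _ "(k, F, f)"]) (use assms in \<open>simp add: represents_def\<close>)

text \<open>The two tuples are concatenated, and each outer function is precomposed with the
  projection onto its own block.\<close>

lemma cyl_functions_joint_representation:
  assumes "u \<in> cyl_functions d \<A>" "v \<in> cyl_functions d \<A>"
  obtains n F G h where "smooth_on n (topspace (Euclidean_space n)) F"
    "smooth_on n (topspace (Euclidean_space n)) G" "\<And>i. i < n \<Longrightarrow> h i \<in> C_inf d \<A>"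
    "u = (\<lambda>\<mu>. F (star_tuple n h \<mu>))" "v = (\<lambda>\<mu>. G (star_tuple n h \<mu>))"
proof -
  obtain k F f where F: "smooth_on k (topspace (Euclidean_space k)) F" "\<And>i. i < k \<Longrightarrow> f i \<in> C_inf d \<A>"
    "u = (\<lambda>\<mu>. F (star_tuple k f \<mu>))"
    using assms(1) by (rule cyl_functionsE) blast
  obtain l G g where G: "smooth_on l (topspace (Euclidean_space l)) G" "\<And>i. i < l \<Longrightarrow> g i \<in> C_inf d \<A>"
    "v = (\<lambda>\<mu>. G (star_tuple l g \<mu>))"
    using assms(2) by (rule cyl_functionsE) blast
  define h where "h i = (if i < k then f i else g (i - k))" for i
  have "star_tuple k f \<mu> = coordinate_block 0 k (star_tuple (k + l) h \<mu>)"
    and "star_tuple l g \<mu> = coordinate_block k l (star_tuple (k + l) h \<mu>)" for \<mu>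
    by (auto simp: star_tuple_def coordinate_block_def h_def)
  then show ?thesis
    using that[of "k + l" "\<lambda>x. F (coordinate_block 0 k x)" "\<lambda>x. G (coordinate_block k l x)" h]
      F G smooth_on_coordinate_block[of 0 k "k + l" F] smooth_on_coordinate_block[of k l "k + l" G]
    by (simp add: h_def)
qed

lemma cyl_functions_add:
  assumes "u \<in> cyl_functions d \<A>" "v \<in> cyl_functions d \<A>"
  shows "u + v \<in> cyl_functions d \<A>"
  using assms
proof (rule cyl_functions_joint_representation)
  fix n F G h
  assume "smooth_on n (topspace (Euclidean_space n)) F" "smooth_on n (topspace (Euclidean_space n)) G"
    "\<And>i. i < n \<Longrightarrow> h i \<in> C_inf d \<A>"
    "u = (\<lambda>\<mu>. F (star_tuple n h \<mu>))" "v = (\<lambda>\<mu>. G (star_tuple n h \<mu>))"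
  then show ?thesis
    using cyl_functionsI[OF smooth_on_add[OF openin_topspace]] by (simp add: plus_fun_def)
qed

lemma cyl_functions_mult:
  assumes "u \<in> cyl_functions d \<A>" "v \<in> cyl_functions d \<A>"
  shows "u * v \<in> cyl_functions d \<A>"
  using assms
proof (rule cyl_functions_joint_representation)
  fix n F G h
  assume "smooth_on n (topspace (Euclidean_space n)) F" "smooth_on n (topspace (Euclidean_space n)) G"
    "\<And>i. i < n \<Longrightarrow> h i \<in> C_inf d \<A>"
    "u = (\<lambda>\<mu>. F (star_tuple n h \<mu>))" "v = (\<lambda>\<mu>. G (star_tuple n h \<mu>))"
  then show ?thesis
    using cyl_functionsI[OF smooth_on_mult[OF openin_topspace]] by (simp add: times_fun_def)
qed

lemma cyl_functions_const: "(\<lambda>\<mu>. c) \<in> cyl_functions d \<A>"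
  \<comment> \<open>A constant is a cylinder function of the empty tuple.\<close>
  using cyl_functionsI[of 0 "\<lambda>x. c"] smooth_on_const[OF openin_topspace] by simp

lemma subspace_cyl_functions: "subspace (cyl_functions d \<A>)"
proof -
  have "r *\<^sub>R u \<in> cyl_functions d \<A>" if "u \<in> cyl_functions d \<A>" for r u
    using cyl_functions_mult[OF cyl_functions_const that] by (simp add: times_fun_def scaleR_fun_def)
  then show ?thesis
    using cyl_functions_const[of 0] cyl_functions_add by (simp add: subspace_def zero_fun_def)
qed

end

section \<open>The flat derivative\<close>

lemma prob_space_measure_of_prob: "prob_space (measure_of_prob \<mu>)"
  and sets_measure_of_prob [simp]: "sets (measure_of_prob \<mu>) = sets borel"
  using measure_of_prob[of \<mu>] by (auto simp: space_prob_algebra)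

lemma measurable_measure_of_prob [simp]:
  "f \<in> borel_measurable (measure_of_prob \<mu>) \<longleftrightarrow> f \<in> borel_measurable borel"
  by (rule measurable_cong_sets[THEN arg_cong[of _ _ "\<lambda>S. f \<in> S"]]) simp_all

text \<open>The convex combination \<open>(1 - t) \<mu> + t \<delta>\<^sub>x\<close> as a two-stage
  experiment: a coin with success probability \<open>t\<close> decides between the Dirac measure and
  \<open>\<mu>\<close>. This reading is for \<open>t\<close> in the unit interval, so derivatives at
  0 are taken within \<open>{0..1}\<close>.\<close>

definition mix :: "'m::topological_space borel_prob \<Rightarrow> 'm \<Rightarrow> real \<Rightarrow> 'm borel_prob" where
  "mix \<mu> x t = Abs_borel_prob
     (measure_pmf (bernoulli_pmf t) \<bind> (\<lambda>b. if b then return borel x else measure_of_prob \<mu>))"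

context closed_connected_oriented_manifold
begin

lemma C_inf_integrable:
  fixes \<mu> :: "'m borel_prob"
  assumes "f \<in> C_inf d \<A>"
  shows "integrable (measure_of_prob \<mu>) f"
proof -
  interpret prob_space "measure_of_prob \<mu>"
    by (rule prob_space_measure_of_prob)
  obtain B where "\<And>x. \<bar>f x\<bar> \<le> B"
    using C_inf_bounded[OF assms] by blast
  then show ?thesis
    using C_inf_borel_measurable[OF assms] by (intro integrable_const_bound[of _ B]) auto
qed

text \<open>Integrating against \<open>mix\<close> averages the two conditional integrals
  \<open>f x\<close> and \<open>star f \<mu>\<close> over the coin; the result is affine in
  \<open>t\<close>.\<close>

lemma star_mix:
  assumes f: "f \<in> C_inf d \<A>" and t: "0 \<le> t" "t \<le> 1"
  shows "star f (mix \<mu> x t) = star f \<mu> + t * (f x - star f \<mu>)"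
proof -
  let ?N = "\<lambda>b. if b then return borel x else measure_of_prob \<mu>"
  have ber: "measure_pmf (bernoulli_pmf t) \<in> space (prob_algebra (count_space UNIV))"
    by (simp add: space_prob_algebra prob_space_measure_pmf)
  have N: "?N \<in> count_space UNIV \<rightarrow>\<^sub>M prob_algebra borel"
    using measure_of_prob[of \<mu>] by (auto simp: space_prob_algebra prob_space_return)
  have "measure_pmf (bernoulli_pmf t) \<bind> ?N \<in> space (prob_algebra borel)"
    using prob_space_bind'[OF ber N] sets_bind'[OF ber N] by (simp add: space_prob_algebra)
  then have meas: "measure_of_prob (mix \<mu> x t) = measure_pmf (bernoulli_pmf t) \<bind> ?N"
    by (simp add: mix_def Abs_borel_prob_inverse)
  obtain B where B: "\<And>x. \<bar>f x\<bar> \<le> B"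
    using C_inf_bounded[OF f] by blast
  have N_emeasure: "emeasure (?N b) (space (?N b)) \<le> ennreal 1" for b
    using prob_space.emeasure_space_1[OF prob_space_measure_of_prob, of \<mu>]
      prob_space.emeasure_space_1[OF prob_space_return[of x borel]] by simp
  have "star f (mix \<mu> x t) = (\<integral>b. (\<integral>y. f y \<partial>?N b) \<partial>measure_pmf (bernoulli_pmf t))"
    unfolding star_def meas
  \<comment> \<open>\<open>B\<close> bounds \<open>f\<close> and \<open>1\<close> bounds the masses
    of the kernel \<open>?N\<close>, as required for integrating in two stages.\<close>
  proof (rule integral_bind[where K = borel and B = B and B' = 1])
    show "?N \<in> measure_pmf (bernoulli_pmf t) \<rightarrow>\<^sub>M subprob_algebra borel"
      using measurable_prob_algebraD[OF N] by (simp cong: measurable_cong_sets)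
  qed (use B N_emeasure C_inf_borel_measurable[OF f] in \<open>auto intro: measure_pmf.finite_measure_axioms\<close>)
  also have "\<dots> = star f \<mu> + t * (f x - star f \<mu>)"
    using t C_inf_borel_measurable[OF f] by (simp add: integral_return star_def algebra_simps)
  finally show ?thesis .
qed

text \<open>A cylinder function sees a measure only through integrals of smooth functions, which
  \<open>star_mix\<close> computes at \<open>t = 0\<close>. This supplies the values at 0 in the
  product rule.\<close>

lemma cyl_functions_mix_0:
  assumes "u \<in> cyl_functions d \<A>"
  shows "u (mix \<mu> x 0) = u \<mu>"
  using assms
proof (rule cyl_functionsE)
  fix k F f
  assume f: "\<And>i. i < k \<Longrightarrow> f i \<in> C_inf d \<A>" and u: "u = (\<lambda>\<mu>. F (star_tuple k f \<mu>))"
  have "star_tuple k f (mix \<mu> x 0) = star_tuple k f \<mu>"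
    using f by (auto simp: star_tuple_def star_mix)
  then show ?thesis by (simp add: u)
qed

text \<open>The derivative of \<open>u\<close> at \<open>\<mu>\<close> towards the Dirac measures, as a function on \<open>M\<close> determined up to
  an additive constant.\<close>

definition flat_derivative :: "('m borel_prob \<Rightarrow> real) \<Rightarrow> 'm borel_prob \<Rightarrow> ('m \<Rightarrow> real) \<Rightarrow> bool" where
  "flat_derivative u \<mu> \<phi> \<longleftrightarrow> \<phi> \<in> C_inf d \<A> \<and>
     (\<exists>c. \<forall>x. ((\<lambda>t. u (mix \<mu> x t)) has_real_derivative \<phi> x + c) (at 0 within {0..1}))"

lemma flat_derivative_C_inf: "flat_derivative u \<mu> \<phi> \<Longrightarrow> \<phi> \<in> C_inf d \<A>"
  by (simp add: flat_derivative_def)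

text \<open>Along \<open>mix\<close> the tuple of integrals runs on a straight line from
  \<open>?p\<close> with velocity \<open>f i x - ?p i\<close>. The contribution of
  \<open>?p i\<close> to the derivative does not depend on \<open>x\<close> and becomes the additive
  constant.\<close>

lemma flat_derivative_cylinder:
  assumes F: "smooth_on k (topspace (Euclidean_space k)) F" and f: "\<And>i. i < k \<Longrightarrow> f i \<in> C_inf d \<A>"
  shows "flat_derivative (\<lambda>\<mu>. F (star_tuple k f \<mu>)) \<mu> (\<Sum>i<k. partial i F (star_tuple k f \<mu>) *\<^sub>R f i)"
    (is "flat_derivative ?u \<mu> ?\<phi>")
proof -
  let ?p = "star_tuple k f \<mu>"
  have "((\<lambda>t. ?u (mix \<mu> x t)) has_real_derivative ?\<phi> x + - (\<Sum>i<k. partial i F ?p * ?p i))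
      (at 0 within {0..1})" for x
  proof -
    define v where "v i = (if i < k then f i x - ?p i else 0)" for i
    have "((\<lambda>t. F (\<lambda>i. ?p i + t * v i)) has_real_derivative (\<Sum>i<k. partial i F ?p * v i)) (at 0)"
      by (rule smooth_on_has_derivative_along_line[OF F]) (auto simp: star_tuple_def v_def)
    from has_field_derivative_at_within[OF this, of "{0..1}"]
    have line: "((\<lambda>t. F (\<lambda>i. ?p i + t * v i)) has_real_derivative (\<Sum>i<k. partial i F ?p * v i))
        (at 0 within {0..1})" .
    have "star_tuple k f (mix \<mu> x t) = (\<lambda>i. ?p i + t * v i)" if "t \<in> {0..1}" for t
      using that f by (auto simp: star_tuple_def v_def star_mix)
    then have "((\<lambda>t. ?u (mix \<mu> x t)) has_real_derivative (\<Sum>i<k. partial i F ?p * v i))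
        (at 0 within {0..1})"
      by (intro has_field_derivative_transform_within[OF line zero_less_one]) auto
    moreover have "(\<Sum>i<k. partial i F ?p * v i) = ?\<phi> x + - (\<Sum>i<k. partial i F ?p * ?p i)"
    proof -
      have "?\<phi> x = (\<Sum>i<k. partial i F ?p * f i x)"
        by (simp add: fun_sum_apply)
      then show ?thesis
        by (simp add: v_def algebra_simps sum_subtractf)
    qed
    ultimately show ?thesis by simp
  qed
  moreover have "?\<phi> \<in> C_inf d \<A>"
    using f by (intro subspace_sum[OF subspace_C_inf] C_inf_scaleR) auto
  ultimately show ?thesis
    unfolding flat_derivative_def by blast
qed

lemma flat_derivative_exists:
  assumes "u \<in> cyl_functions d \<A>"
  obtains \<phi> where "flat_derivative u \<mu> \<phi>"
proof -
  obtain k F f where F: "smooth_on k (topspace (Euclidean_space k)) F" "\<And>i. i < k \<Longrightarrow> f i \<in> C_inf d \<A>"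
    and u: "u = (\<lambda>\<mu>. F (star_tuple k f \<mu>))"
    using assms by (rule cyl_functionsE) blast
  show ?thesis
    by (rule that) (unfold u, rule flat_derivative_cylinder[OF F])
qed

lemma tangent_space_flat_derivative_unique:
  assumes \<phi>: "flat_derivative u \<mu> \<phi>" and \<psi>: "flat_derivative u \<mu> \<psi>" and v: "v \<in> tangent_space d \<A> x"
  shows "v \<phi> = v \<psi>"
proof -
  obtain a where a: "\<And>x. ((\<lambda>t. u (mix \<mu> x t)) has_real_derivative \<phi> x + a) (at 0 within {0..1})"
    using \<phi> by (auto simp: flat_derivative_def)
  obtain b where b: "\<And>x. ((\<lambda>t. u (mix \<mu> x t)) has_real_derivative \<psi> x + b) (at 0 within {0..1})"
    using \<psi> by (auto simp: flat_derivative_def)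
  \<comment> \<open>The origin is a limit point of the interval, which makes the one-sided
    derivative unique.\<close>
  have "at (0 :: real) within {0..1} \<noteq> bot"
    by (simp add: at_within_Icc_at_right)
  then have "\<phi> x + a = \<psi> x + b" for x
    using has_field_derivative_unique[OF a b] by blast
  then have "\<phi> = \<psi> + (\<lambda>x. b - a)"
    by (auto simp: fun_eq_iff algebra_simps)
  then show ?thesis
    using tangent_space_add[OF v flat_derivative_C_inf[OF \<psi>] C_inf_const] tangent_space_const[OF v] by simp
qed

lemma flat_derivative_add:
  assumes "flat_derivative u \<mu> \<phi>" "flat_derivative v \<mu> \<psi>"
  shows "flat_derivative (u + v) \<mu> (\<phi> + \<psi>)"
proof -
  obtain a where a: "\<And>x. ((\<lambda>t. u (mix \<mu> x t)) has_real_derivative \<phi> x + a) (at 0 within {0..1})"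
    using assms(1) by (auto simp: flat_derivative_def)
  obtain b where b: "\<And>x. ((\<lambda>t. v (mix \<mu> x t)) has_real_derivative \<psi> x + b) (at 0 within {0..1})"
    using assms(2) by (auto simp: flat_derivative_def)
  have "((\<lambda>t. (u + v) (mix \<mu> x t)) has_real_derivative (\<phi> + \<psi>) x + (a + b)) (at 0 within {0..1})" for x
    using DERIV_add[OF a b] by (simp add: algebra_simps)
  then show ?thesis
    using C_inf_add assms unfolding flat_derivative_def by blast
qed

text \<open>The product rule in \<open>t\<close>. The additive constants combine to
  \<open>v \<mu> * a + u \<mu> * b\<close>, again independent of \<open>x\<close>.\<close>

lemma flat_derivative_mult:
  assumes uv: "u \<in> cyl_functions d \<A>" "v \<in> cyl_functions d \<A>"
    and "flat_derivative u \<mu> \<phi>" "flat_derivative v \<mu> \<psi>"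
  shows "flat_derivative (u * v) \<mu> (v \<mu> *\<^sub>R \<phi> + u \<mu> *\<^sub>R \<psi>)"
proof -
  obtain a where a: "\<And>x. ((\<lambda>t. u (mix \<mu> x t)) has_real_derivative \<phi> x + a) (at 0 within {0..1})"
    using assms(3) by (auto simp: flat_derivative_def)
  obtain b where b: "\<And>x. ((\<lambda>t. v (mix \<mu> x t)) has_real_derivative \<psi> x + b) (at 0 within {0..1})"
    using assms(4) by (auto simp: flat_derivative_def)
  have "((\<lambda>t. (u * v) (mix \<mu> x t)) has_real_derivative
      (v \<mu> *\<^sub>R \<phi> + u \<mu> *\<^sub>R \<psi>) x + (v \<mu> * a + u \<mu> * b)) (at 0 within {0..1})" for x
    using DERIV_mult[OF a b] uv[THEN cyl_functions_mix_0] by (simp add: algebra_simps)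
  then show ?thesis
    using C_inf_add C_inf_scaleR assms unfolding flat_derivative_def by blast
qed

lemma flat_derivative_scaleR:
  assumes "flat_derivative u \<mu> \<phi>"
  shows "flat_derivative (r *\<^sub>R u) \<mu> (r *\<^sub>R \<phi>)"
proof -
  obtain a where a: "\<And>x. ((\<lambda>t. u (mix \<mu> x t)) has_real_derivative \<phi> x + a) (at 0 within {0..1})"
    using assms by (auto simp: flat_derivative_def)
  have "((\<lambda>t. (r *\<^sub>R u) (mix \<mu> x t)) has_real_derivative (r *\<^sub>R \<phi>) x + r * a) (at 0 within {0..1})" for x
    using DERIV_cmult[OF a, of r] by (simp add: algebra_simps)
  then show ?thesis
    using C_inf_scaleR assms unfolding flat_derivative_def by blast
qed

text \<open>The representation picked by \<open>SOME\<close> yields one flat derivative of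
  \<open>u\<close>, and on it \<open>v\<close> takes the same value as on any other. So
  \<open>\<phi>\<close> may be chosen freely, for instance as built by the sum and product
  rules.\<close>

lemma eval_at_cyl_D:
  assumes u: "u \<in> cyl_functions d \<A>" and \<phi>: "flat_derivative u \<mu> \<phi>" and v: "v \<in> tangent_space d \<A> x"
  shows "eval_at (cyl_D d \<A> u) \<mu> x v = v \<phi>"
proof -
  obtain k F f where kFf: "(SOME \<rho>. represents d \<A> \<rho> u) = (k, F, f)"
    by (cases "SOME \<rho>. represents d \<A> \<rho> u")
  have "\<exists>\<rho>. represents d \<A> \<rho> u"
    using u by (simp add: cyl_functions_def)
  from someI_ex[OF this] have "represents d \<A> (k, F, f) u"
    by (simp add: kFf)
  then have F: "smooth_on k (topspace (Euclidean_space k)) F" and f: "\<And>i. i < k \<Longrightarrow> f i \<in> C_inf d \<A>"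
    and u_eq: "u = (\<lambda>\<mu>. F (star_tuple k f \<mu>))"
    by (auto simp: represents_def)
  let ?c = "\<lambda>i. formal_pair (\<lambda>\<mu>. partial i F (star_tuple k f \<mu>)) (differential d \<A> (f i))"
  let ?a = "\<lambda>i. partial i F (star_tuple k f \<mu>)"
  \<comment> \<open>The coefficients are cylinder functions because partial derivatives of smooth
    functions are smooth.\<close>
  have c: "?c i \<in> formal_sums (cyl_functions d \<A>) (one_forms d \<A>)" if "i \<in> {..<k}" for i
    using that f F by (intro formal_pair_in_formal_sums differential_in_one_forms cyl_functionsI smooth_on_partial) auto
  have "cyl_D d \<A> u = tensor_class (cyl_functions d \<A>) (one_forms d \<A>) (\<Sum>i<k. ?c i)"
    by (simp add: cyl_D_def kFf)
  then have "eval_at (cyl_D d \<A> u) \<mu> = formal_lift (\<lambda>u w. u \<mu> *\<^sub>R w) (\<Sum>i<k. ?c i)"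
    by (simp only: eval_at_def
        tensor_lift_class_bilinear[OF subspace_sum[OF subspace_formal_sums c] bilinear_on_eval])
  also have "\<dots> = (\<Sum>i<k. ?a i *\<^sub>R differential d \<A> (f i))"
    by (subst formal_lift_sum[OF _ c]) auto
  finally have "eval_at (cyl_D d \<A> u) \<mu> x v = (\<Sum>i<k. ?a i *\<^sub>R differential d \<A> (f i)) x v"
    by simp
  also have "\<dots> = (\<Sum>i<k. ?a i * v (f i))"
    using v by (simp add: fun_sum_apply differential_def)
  also have "\<dots> = v (\<Sum>i<k. ?a i *\<^sub>R f i)"
    using linear_on_sum[OF subspace_C_inf, of "{..<k}" f v ?a] f
      tangent_space_add[OF v] tangent_space_scaleR[OF v] by simp
  also have "\<dots> = v \<phi>"
  proof (rule tangent_space_flat_derivative_unique[OF _ \<phi> v])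
    show "flat_derivative u \<mu> (\<Sum>i<k. ?a i *\<^sub>R f i)"
      unfolding u_eq by (rule flat_derivative_cylinder[OF F f])
  qed
  finally show ?thesis .
qed

section \<open>The connection\<close>

lemma eval_at_cyl_vector_field:
  "V \<in> cyl_vector_fields d \<A> \<Longrightarrow> eval_at V \<mu> \<in> vector_fields d \<A>"
  unfolding cyl_vector_fields_def by (rule eval_at_in[OF subspace_cyl_functions subspace_vector_fields])

lemma eval_at_cyl_one_form:
  "\<Omega> \<in> cyl_one_forms d \<A> \<Longrightarrow> eval_at \<Omega> \<mu> \<in> one_forms d \<A>"
  unfolding cyl_one_forms_def by (rule eval_at_in[OF subspace_cyl_functions subspace_one_forms])

section \<open>The action of a cylinder vector field as a derivation\<close>

lemma vf_action_flat_derivative: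
  assumes "V \<in> cyl_vector_fields d \<A>" "u \<in> cyl_functions d \<A>" "flat_derivative u \<mu> \<phi>"
  shows "vf_action d \<A> V u \<mu> = star (\<lambda>x. eval_at V \<mu> x \<phi>) \<mu>"
  using eval_at_cyl_D[OF assms(2,3) vector_fields_tangent[OF eval_at_cyl_vector_field[OF assms(1)]]]
  by (simp add: vf_action_def pairing_def star_def)

lemma star_add: "f \<in> C_inf d \<A> \<Longrightarrow> g \<in> C_inf d \<A> \<Longrightarrow> star (\<lambda>x. f x + g x) \<mu> = star f \<mu> + star g \<mu>"
  unfolding star_def by (intro Bochner_Integration.integral_add C_inf_integrable)

lemma star_mult: "star (\<lambda>x. r * f x) \<mu> = r * star f \<mu>"
  by (simp add: star_def)

lemma vf_action_add:
  assumes V: "V \<in> cyl_vector_fields d \<A>" and u: "u \<in> cyl_functions d \<A>" and v: "v \<in> cyl_functions d \<A>"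
  shows "vf_action d \<A> V (u + v) \<mu> = vf_action d \<A> V u \<mu> + vf_action d \<A> V v \<mu>"
proof -
  obtain \<phi> where \<phi>: "flat_derivative u \<mu> \<phi>" using flat_derivative_exists[OF u] .
  obtain \<psi> where \<psi>: "flat_derivative v \<mu> \<psi>" using flat_derivative_exists[OF v] .
  note C = flat_derivative_C_inf[OF \<phi>] flat_derivative_C_inf[OF \<psi>]
  note W = eval_at_cyl_vector_field[OF V, of \<mu>]
  have "eval_at V \<mu> x (\<phi> + \<psi>) = eval_at V \<mu> x \<phi> + eval_at V \<mu> x \<psi>" for x
    by (rule tangent_space_add[OF vector_fields_tangent[OF W] C])
  then show ?thesis
    using star_add[OF vector_fields_smooth[OF W C(1)] vector_fields_smooth[OF W C(2)], of \<mu>]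
    by (simp only: vf_action_flat_derivative[OF V u \<phi>] vf_action_flat_derivative[OF V v \<psi>]
        vf_action_flat_derivative[OF V cyl_functions_add[OF u v] flat_derivative_add[OF \<phi> \<psi>]])
qed

text \<open>The Leibniz rule comes from the product rule in \<open>t\<close> inside
  \<open>flat_derivative_mult\<close>; the tangent vectors and the integral contribute
  linearity.\<close>

lemma vf_action_mult:
  assumes V: "V \<in> cyl_vector_fields d \<A>" and u: "u \<in> cyl_functions d \<A>" and v: "v \<in> cyl_functions d \<A>"
  shows "vf_action d \<A> V (u * v) \<mu> = v \<mu> * vf_action d \<A> V u \<mu> + u \<mu> * vf_action d \<A> V v \<mu>"
proof -
  obtain \<phi> where \<phi>: "flat_derivative u \<mu> \<phi>" using flat_derivative_exists[OF u] .
  obtain \<psi> where \<psi>: "flat_derivative v \<mu> \<psi>" using flat_derivative_exists[OF v] .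
  note C = flat_derivative_C_inf[OF \<phi>] flat_derivative_C_inf[OF \<psi>]
  note W = eval_at_cyl_vector_field[OF V, of \<mu>]
  note smooth = vector_fields_smooth[OF W C_inf_scaleR[OF C(1)]] vector_fields_smooth[OF W C_inf_scaleR[OF C(2)]]
  have "eval_at V \<mu> x (v \<mu> *\<^sub>R \<phi> + u \<mu> *\<^sub>R \<psi>) = eval_at V \<mu> x (v \<mu> *\<^sub>R \<phi>) + eval_at V \<mu> x (u \<mu> *\<^sub>R \<psi>)" for x
    by (rule tangent_space_add[OF vector_fields_tangent[OF W] C_inf_scaleR[OF C(1)] C_inf_scaleR[OF C(2)]])
  moreover have "eval_at V \<mu> x (r *\<^sub>R \<phi>) = r * eval_at V \<mu> x \<phi>" "eval_at V \<mu> x (r *\<^sub>R \<psi>) = r * eval_at V \<mu> x \<psi>" for x r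
    by (rule tangent_space_scaleR[OF vector_fields_tangent[OF W]] C)+
  ultimately show ?thesis
    using star_add[OF smooth, of "v \<mu>" "u \<mu>" \<mu>]
    by (simp only: star_mult vf_action_flat_derivative[OF V u \<phi>] vf_action_flat_derivative[OF V v \<psi>]
        vf_action_flat_derivative[OF V cyl_functions_mult[OF u v] flat_derivative_mult[OF u v \<phi> \<psi>]])
qed

lemma vf_action_scaleR:
  assumes V: "V \<in> cyl_vector_fields d \<A>" and u: "u \<in> cyl_functions d \<A>"
  shows "vf_action d \<A> V (r *\<^sub>R u) \<mu> = r * vf_action d \<A> V u \<mu>"
proof -
  obtain \<phi> where \<phi>: "flat_derivative u \<mu> \<phi>" using flat_derivative_exists[OF u] .
  note W = eval_at_cyl_vector_field[OF V, of \<mu>]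
  have "eval_at V \<mu> x (r *\<^sub>R \<phi>) = r * eval_at V \<mu> x \<phi>" for x
    by (rule tangent_space_scaleR[OF vector_fields_tangent[OF W] flat_derivative_C_inf[OF \<phi>]])
  then show ?thesis
    by (simp only: star_mult vf_action_flat_derivative[OF V u \<phi>]
        vf_action_flat_derivative[OF V subspace_scale[OF subspace_cyl_functions u] flat_derivative_scaleR[OF \<phi>]])
qed

text \<open>Isolates the factor of the double integral that depends on \<open>w\<close>; the other
  factor is \<open>vf_action\<close>.\<close>

definition flux :: "'m cyl_one_form \<Rightarrow> 'm borel_prob \<Rightarrow> ('m \<Rightarrow> 'm tvector) \<Rightarrow> real" where
  "flux \<Omega> \<mu> w = star (\<lambda>x. eval_at \<Omega> \<mu> x (w x)) \<mu>"

lemma flux_add: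
  assumes "\<Omega> \<in> cyl_one_forms d \<A>" "w \<in> vector_fields d \<A>" "w' \<in> vector_fields d \<A>"
  shows "flux \<Omega> \<mu> (w + w') = flux \<Omega> \<mu> w + flux \<Omega> \<mu> w'"
proof -
  note \<Omega> = eval_at_cyl_one_form[OF assms(1), of \<mu>]
  show ?thesis
    using star_add[OF one_forms_smooth[OF \<Omega> assms(2)] one_forms_smooth[OF \<Omega> assms(3)], of \<mu>]
    by (simp only: flux_def one_forms_add[OF \<Omega> assms(2,3)])
qed

lemma flux_scaleR:
  assumes "\<Omega> \<in> cyl_one_forms d \<A>" "w \<in> vector_fields d \<A>"
  shows "flux \<Omega> \<mu> (r *\<^sub>R w) = r * flux \<Omega> \<mu> w"
  by (simp only: flux_def one_forms_scaleR[OF eval_at_cyl_one_form[OF assms(1)] assms(2)] star_mult)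

lemma pairing_eq_flux: "pairing \<Omega> Z \<mu> = flux \<Omega> \<mu> (eval_at Z \<mu>)"
  by (simp add: pairing_def flux_def star_def)

section \<open>Factorization by Fubini and the product rule\<close>

lemma integral_pair_C_inf:
  fixes \<mu> :: "'m borel_prob"
  assumes "f \<in> C_inf d \<A>" "g \<in> C_inf d \<A>"
  shows "(\<integral>z. f (fst z) * g (snd z) \<partial>(measure_of_prob \<mu> \<Otimes>\<^sub>M measure_of_prob \<mu>)) = star f \<mu> * star g \<mu>"
proof -
  interpret prob_space "measure_of_prob \<mu>"
    by (rule prob_space_measure_of_prob)
  interpret pair_prob_space "measure_of_prob \<mu>" "measure_of_prob \<mu>" ..
  note int = assms[THEN C_inf_integrable, of \<mu>]
  note [measurable] = int[THEN borel_measurable_integrable]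
  \<comment> \<open>The inner integral of the absolute value is a constant multiple of the absolute
    value of \<open>f\<close>, hence integrable.\<close>
  have "integrable (measure_of_prob \<mu> \<Otimes>\<^sub>M measure_of_prob \<mu>) (\<lambda>z. f (fst z) * g (snd z))"
    by (rule Fubini_integrable) (use int in \<open>auto simp: abs_mult\<close>)
  from integral_fst'[OF this] show ?thesis
    by (simp add: star_def)
qed

text \<open>The double integral factorizes for \<open>u\<close> and \<open>w\<close> in the two
  spaces; the representative of \<open>Z\<close> is supported on such pairs, so the lifts
  agree.\<close>

lemma nabla_int_eq:
  assumes Z: "Z \<in> cyl_vector_fields d \<A>" and V: "V \<in> cyl_vector_fields d \<A>" and \<Omega>: "\<Omega> \<in> cyl_one_forms d \<A>"
  shows "nabla_int d \<A> Z V \<Omega> \<mu> = tensor_lift (\<lambda>u w. vf_action d \<A> V u \<mu> * flux \<Omega> \<mu> w) Z"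
proof -
  have "(\<integral>z. eval_at (cyl_D d \<A> u) \<mu> (fst z) (eval_at V \<mu> (fst z)) * eval_at \<Omega> \<mu> (snd z) (w (snd z))
       \<partial>(measure_of_prob \<mu> \<Otimes>\<^sub>M measure_of_prob \<mu>)) = vf_action d \<A> V u \<mu> * flux \<Omega> \<mu> w"
    if u: "u \<in> cyl_functions d \<A>" and w: "w \<in> vector_fields d \<A>" for u w
  proof -
    obtain \<phi> where \<phi>: "flat_derivative u \<mu> \<phi>" using flat_derivative_exists[OF u] .
    note W = eval_at_cyl_vector_field[OF V, of \<mu>]
    have "(\<lambda>x. eval_at (cyl_D d \<A> u) \<mu> x (eval_at V \<mu> x)) = (\<lambda>x. eval_at V \<mu> x \<phi>)"
      using eval_at_cyl_D[OF u \<phi> vector_fields_tangent[OF W]] by simp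
    then have "(\<lambda>x. eval_at (cyl_D d \<A> u) \<mu> x (eval_at V \<mu> x)) \<in> C_inf d \<A>"
      using vector_fields_smooth[OF W flat_derivative_C_inf[OF \<phi>]] by simp
    from integral_pair_C_inf[OF this one_forms_smooth[OF eval_at_cyl_one_form[OF \<Omega>] w], of \<mu> \<mu>]
    show ?thesis
      by (simp add: vf_action_def pairing_def flux_def star_def)
  qed
  then show ?thesis
    unfolding nabla_int_def tensor_lift_def
    by (intro formal_lift_cong[of _ "cyl_functions d \<A>" "vector_fields d \<A>"] tensor_rep_in_formal_sums
        subspace_cyl_functions subspace_vector_fields Z[unfolded cyl_vector_fields_def])
qed

text \<open>Thus the formula on elementary tensors extends to the tensor product independently of
  representatives.\<close>

lemma bilinear_on_nabla_int:
  assumes "V \<in> cyl_vector_fields d \<A>" "\<Omega> \<in> cyl_one_forms d \<A>"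
  shows "bilinear_on (cyl_functions d \<A>) (vector_fields d \<A>) (\<lambda>u w. vf_action d \<A> V u \<mu> * flux \<Omega> \<mu> w)"
  unfolding bilinear_on_def
  using vf_action_add[OF assms(1)] vf_action_scaleR[OF assms(1)] flux_add[OF assms(2)] flux_scaleR[OF assms(2)]
  by (simp add: algebra_simps del: plus_fun_apply scaleR_fun_apply)

text \<open>The evaluation of \<open>Z\<close> at \<open>\<mu>\<close> is a finite combination of
  vector fields, and \<open>flux\<close> is linear on these.\<close>

lemma tensor_lift_pairing:
  assumes Z: "Z \<in> cyl_vector_fields d \<A>" and \<Omega>: "\<Omega> \<in> cyl_one_forms d \<A>"
  shows "tensor_lift (\<lambda>u w. u \<mu> * flux \<Omega> \<mu> w) Z = pairing \<Omega> Z \<mu>"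
proof -
  let ?c = "tensor_rep Z"
  have c: "?c \<in> formal_sums (cyl_functions d \<A>) (vector_fields d \<A>)"
    using tensor_rep_in_formal_sums[OF subspace_cyl_functions subspace_vector_fields] Z
    by (simp add: cyl_vector_fields_def)
  have "pairing \<Omega> Z \<mu> = flux \<Omega> \<mu> (\<Sum>p | ?c p \<noteq> 0. (?c p * fst p \<mu>) *\<^sub>R snd p)"
    by (simp add: pairing_eq_flux eval_at_def tensor_lift_def formal_lift_def)
  also have "\<dots> = (\<Sum>p | ?c p \<noteq> 0. (?c p * fst p \<mu>) *\<^sub>R flux \<Omega> \<mu> (snd p))"
    by (rule linear_on_sum[OF subspace_vector_fields formal_sums_finite[OF c]])
      (auto dest: formal_sums_support[OF c] simp: flux_add[OF \<Omega>] flux_scaleR[OF \<Omega>]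
        simp del: plus_fun_apply scaleR_fun_apply)
  finally show ?thesis
    by (simp add: tensor_lift_def formal_lift_def mult.assoc)
qed

text \<open>Multiplication by \<open>v\<close> replaces \<open>u\<close> by \<open>v * u\<close> in
  each pair of the representative. The Leibniz rule splits each term in two: the first parts sum to
  a multiple of the original lift, the second to a multiple of the pairing.\<close>

lemma nabla_int_product_rule:
  assumes v: "v \<in> cyl_functions d \<A>" and Z: "Z \<in> cyl_vector_fields d \<A>"
    and V: "V \<in> cyl_vector_fields d \<A>" and \<Omega>: "\<Omega> \<in> cyl_one_forms d \<A>"
  shows "nabla_int d \<A> (vf_mult d \<A> v Z) V \<Omega> \<mu> =
    v \<mu> * nabla_int d \<A> Z V \<Omega> \<mu> + vf_action d \<A> V v \<mu> * pairing \<Omega> Z \<mu>"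
proof -
  let ?A = "cyl_functions d \<A>" and ?B = "vector_fields d \<A>" and ?c = "tensor_rep Z"
  let ?h = "\<lambda>u w. vf_action d \<A> V u \<mu> * flux \<Omega> \<mu> w"
  have Zt: "Z \<in> tensor_space ?A ?B"
    using Z by (simp add: cyl_vector_fields_def)
  have vu: "v * u \<in> ?A" if "u \<in> ?A" for u
    using cyl_functions_mult[OF v that] .
  have c: "?c \<in> formal_sums ?A ?B"
    by (rule tensor_rep_in_formal_sums[OF subspace_cyl_functions subspace_vector_fields Zt])
  have "vf_mult d \<A> v Z \<in> cyl_vector_fields d \<A>"
    unfolding cyl_vector_fields_def
    by (rule tensor_module_mult_in_tensor_space[OF subspace_cyl_functions subspace_vector_fields Zt vu])
  then have "nabla_int d \<A> (vf_mult d \<A> v Z) V \<Omega> \<mu> = tensor_lift ?h (vf_mult d \<A> v Z)"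
    by (rule nabla_int_eq[OF _ V \<Omega>])
  also have "\<dots> = formal_lift (\<lambda>u w. ?h (v * u) w) ?c"
    unfolding tensor_lift_def[of _ Z, symmetric]
    by (rule tensor_lift_module_mult[OF subspace_cyl_functions subspace_vector_fields
          bilinear_on_nabla_int[OF V \<Omega>] Zt vu])
  also have "\<dots> = formal_lift (\<lambda>u w. v \<mu> * ?h u w + vf_action d \<A> V v \<mu> * (u \<mu> * flux \<Omega> \<mu> w)) ?c"
    by (rule formal_lift_cong[OF c]) (simp only: vf_action_mult[OF V v], simp add: algebra_simps)
  also have "\<dots> = v \<mu> * formal_lift ?h ?c + vf_action d \<A> V v \<mu> * formal_lift (\<lambda>u w. u \<mu> * flux \<Omega> \<mu> w) ?c"
    by (simp add: formal_lift_def sum_distrib_left sum.distrib[symmetric] algebra_simps)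
  finally show ?thesis
    using nabla_int_eq[OF Z V \<Omega>, of \<mu>] tensor_lift_pairing[OF Z \<Omega>, of \<mu>] by (simp add: tensor_lift_def)
qed

end

theorem proposition2p10:
  fixes d :: nat and \<A> :: "'m::{t2_space,second_countable_topology} chart set"
  assumes "closed_connected_oriented_manifold d \<A>"
  shows "(\<forall>Z\<in>cyl_vector_fields d \<A>. \<forall>Z'\<in>cyl_vector_fields d \<A>.
            \<forall>V\<in>cyl_vector_fields d \<A>. \<forall>\<Omega>\<in>cyl_one_forms d \<A>. \<forall>\<mu>.
              nabla_int d \<A> (vf_add d \<A> Z Z') V \<Omega> \<mu> =
              nabla_int d \<A> Z V \<Omega> \<mu> + nabla_int d \<A> Z' V \<Omega> \<mu>) \<and>
         (\<forall>r. \<forall>Z\<in>cyl_vector_fields d \<A>.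
            \<forall>V\<in>cyl_vector_fields d \<A>. \<forall>\<Omega>\<in>cyl_one_forms d \<A>. \<forall>\<mu>.
              nabla_int d \<A> (vf_scale d \<A> r Z) V \<Omega> \<mu> = r * nabla_int d \<A> Z V \<Omega> \<mu>) \<and>
         (\<forall>v\<in>cyl_functions d \<A>. \<forall>Z\<in>cyl_vector_fields d \<A>.
            \<forall>V\<in>cyl_vector_fields d \<A>. \<forall>\<Omega>\<in>cyl_one_forms d \<A>. \<forall>\<mu>.
              nabla_int d \<A> (vf_mult d \<A> v Z) V \<Omega> \<mu> =
              v \<mu> * nabla_int d \<A> Z V \<Omega> \<mu> + vf_action d \<A> V v \<mu> * pairing \<Omega> Z \<mu>)"
proof -
  interpret closed_connected_oriented_manifold d \<A>
    by (rule assms)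
  note S = subspace_cyl_functions subspace_vector_fields
  show ?thesis
  proof (intro conjI ballI allI)
    fix Z Z' V :: "'m cyl_vector_field" and \<Omega> :: "'m cyl_one_form" and \<mu> :: "'m borel_prob"
    assume *: "Z \<in> cyl_vector_fields d \<A>" "Z' \<in> cyl_vector_fields d \<A>"
      "V \<in> cyl_vector_fields d \<A>" "\<Omega> \<in> cyl_one_forms d \<A>"
    note Z = *(1,2)[unfolded cyl_vector_fields_def]
    \<comment> \<open>\<open>nabla_int_eq\<close> applies to elements of the tensor space, so
      closure under addition comes first.\<close>
    have "vf_add d \<A> Z Z' \<in> cyl_vector_fields d \<A>"
      unfolding cyl_vector_fields_def by (rule tensor_add_in_tensor_space[OF S Z])
    with * show "nabla_int d \<A> (vf_add d \<A> Z Z') V \<Omega> \<mu> =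
        nabla_int d \<A> Z V \<Omega> \<mu> + nabla_int d \<A> Z' V \<Omega> \<mu>"
      by (simp only: nabla_int_eq tensor_lift_add[OF S bilinear_on_nabla_int Z])
  next
    fix r :: real and Z V :: "'m cyl_vector_field" and \<Omega> :: "'m cyl_one_form" and \<mu> :: "'m borel_prob"
    assume *: "Z \<in> cyl_vector_fields d \<A>" "V \<in> cyl_vector_fields d \<A>" "\<Omega> \<in> cyl_one_forms d \<A>"
    note Z = *(1)[unfolded cyl_vector_fields_def]
    have "vf_scale d \<A> r Z \<in> cyl_vector_fields d \<A>"
      unfolding cyl_vector_fields_def by (rule tensor_scale_in_tensor_space[OF S Z])
    with * show "nabla_int d \<A> (vf_scale d \<A> r Z) V \<Omega> \<mu> = r * nabla_int d \<A> Z V \<Omega> \<mu>"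
      by (simp only: nabla_int_eq tensor_lift_scale[OF S bilinear_on_nabla_int Z] real_scaleR_def)
  qed (rule nabla_int_product_rule)
qed

end
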